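(* Let $n \geq 1$ be an integer and let $g = 2n$. Then \[ \frac{1}{\pi}\sqrt[g]{4\cdot g!} \;\leq\; \delta_{2g}, \] where $\delta_{2g}$ is Hermite's constant for symplectic lattices of dimension $2g$.
   Context: Let $\mathcal{H}_g = \{ Z = X + iY \in M_g(\mathbb{C}) \mid X, Y \in M_g(\mathbb{R}),\ X = X^T,\ Y = Y^T,\ Y > 0 \}$ be Siegel's upper half space ($Y>0$ means positive definite). For $Z = X+iY \in \mathcal{H}_g$ let \[ P_Z = \begin{pmatrix} \sqrt{Y^{-1}} & 0 \\ 0 & \sqrt{Y} \end{pmatrix}\begin{pmatrix} \mathrm{Id}_g & X \\ 0 & \mathrm{Id}_g \end{pmatrix} = \begin{pmatrix} \sqrt{Y^{-1}} & \sqrt{Y^{-1}}X \\ 0 & \sqrt{Y} \end{pmatrix} \in M_{2g}(\mathbb{R}), \] where $\sqrt{\cdot}$ denotes the symmetric positive definite square root of a symmetric positive definite matrix. The symplectic lattices of dimension $2g$ are the lattices $P_Z\cdot\mathbb{Z}^{2g}$ with $Z \in \mathcal{H}_g$ (equivalently, the lattices in $\mathbb{R}^{2g}$ having a basis whose matrix lies in $Sp_{2g}(\mathbb{R})$). Hermite's constant for symplectic lattices of dimension $2g$ is \[ \delta_{2g} = \max_{Z \in \mathcal{H}_g}\ \min_{l \in \mathbb{Z}^{2g}\setminus\{0\}} \| P_Z \cdot l \|_2^2 , \] with $\|\cdot\|_2$ the Euclidean norm on $\mathbb{R}^{2g}$. *)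

theory Defs
  imports "HOL-Analysis.Analysis"
begin

definition pos_def_mat :: "real^'n^'n \<Rightarrow> bool" where
  "pos_def_mat A \<longleftrightarrow> (\<forall>v. v \<noteq> 0 \<longrightarrow> v \<bullet> (A *v v) > 0)"

definition mat_Re :: "complex^'n^'m \<Rightarrow> real^'n^'m" where
  "mat_Re Z = (\<chi> i j. Re (Z $ i $ j))"

definition mat_Im :: "complex^'n^'m \<Rightarrow> real^'n^'m" where
  "mat_Im Z = (\<chi> i j. Im (Z $ i $ j))"

definition siegel_half_space :: "(complex^'g^'g) set" where
  "siegel_half_space =
    {Z. transpose (mat_Re Z) = mat_Re Z \<and> transpose (mat_Im Z) = mat_Im Z \<and> pos_def_mat (mat_Im Z)}"

(* Meaningful only for symmetric positive definite A, where the square root exists and is unique. *)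
definition mat_sqrt :: "real^'n^'n \<Rightarrow> real^'n^'n" where
  "mat_sqrt A = (THE B. transpose B = B \<and> pos_def_mat B \<and> B ** B = A)"

definition block_mat ::
  "real^'n^'m \<Rightarrow> real^'k^'m \<Rightarrow> real^'n^'l \<Rightarrow> real^'k^'l \<Rightarrow> real^('n + 'k)^('m + 'l)" where
  "block_mat A B C D =
    (\<chi> i j. case i of
       Inl a \<Rightarrow> (case j of Inl b \<Rightarrow> A $ a $ b | Inr b \<Rightarrow> B $ a $ b)
     | Inr a \<Rightarrow> (case j of Inl b \<Rightarrow> C $ a $ b | Inr b \<Rightarrow> D $ a $ b))"

definition siegel_mat :: "complex^'g^'g \<Rightarrow> real^('g + 'g)^('g + 'g)" where
  "siegel_mat Z =
    block_mat (mat_sqrt (matrix_inv (mat_Im Z))) 0 0 (mat_sqrt (mat_Im Z)) **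
    block_mat (mat 1) (mat_Re Z) 0 (mat 1)"

definition int_vecs :: "(real^'n) set" where
  "int_vecs = {l. \<forall>i. l $ i \<in> \<int>}"

(* The infimum is a minimum, since the lattice spanned by the columns of the
   (invertible) matrix siegel_mat Z is discrete. *)
definition lattice_min :: "complex^'g^'g \<Rightarrow> real" where
  "lattice_min Z = (INF l \<in> int_vecs - {0}. (norm (siegel_mat Z *v l))\<^sup>2)"

(* The constant in dimension 2g, where g = CARD('g).  The library's Max is
   restricted to finite sets, hence the supremum; the set of values is bounded
   above (by the classical Hermite constant in dimension 2g, as det (siegel_mat Z) = 1)
   and attains its supremum. *)
definition symplectic_hermite :: "'g::finite itself \<Rightarrow> real" where
  "symplectic_hermite _ = (SUP Z \<in> (siegel_half_space :: (complex^'g^'g) set). lattice_min Z)"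

end

theory Submission
  imports Defs "HOL-Number_Theory.Residues"
begin

text \<open>
  The bound comes from an averaging argument over a finite family of symplectic lattices which all
  carry an isometry of order four.

  Let \<open>p\<close> be a prime and \<open>T\<close> a symmetric integral \<open>g \<times> g\<close> matrix. At the point
  \<open>Z = (T + i Id) / p\<close> of Siegel's space the lattice is
  \<open>p\<^sup>-\<^sup>1\<^sup>/\<^sup>2 {(u, x) | u \<equiv> T x mod p}\<close>, up to the parametrisation by \<open>l = (a, x)\<close> with
  \<open>u = p a + T x\<close> (\<open>norm_siegel_mat_congruence_point\<close>). So its minimum is at least \<open>r\<close> as soon as
  no nonzero integral pair \<open>(u, x)\<close> with \<open>u \<equiv> T x\<close> has squared norm below \<open>r p\<close>.

  As \<open>g = 2 n\<close> is even, \<open>\<int>\<^sup>g\<close> can be read as \<open>\<int>[i]\<^sup>n\<close>. Let \<open>T\<close> range over the symmetric matrices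
  modulo \<open>p\<close> that anticommute with multiplication by \<open>i\<close>; these are the maps
  \<open>x \<mapsto> conj (S x)\<close> with \<open>S\<close> complex symmetric. Two facts make the count work.
  Firstly, \<open>(u, x) \<mapsto> (i u, - i x)\<close> is an isometry of every such lattice, and its orbits on nonzero
  vectors have four elements (\<open>solves_mul_i\<close>, \<open>card_orbit\<close>). Secondly, if \<open>p \<equiv> 3 mod 4\<close>, then
  \<open>\<int>[i] / p\<close> is a field, so a vector \<open>x\<close> that is nonzero modulo \<open>p\<close> is sent by some member of the
  family to any prescribed \<open>u\<close>; the family being a group, each pair \<open>(u, x)\<close> then lies in the
  lattice of at most the fraction \<open>p\<^sup>-\<^sup>g\<close> of its members (\<open>card_solutions_le\<close>).

  The number of integral pairs of squared norm below \<open>r p\<close> is asymptotically the volume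
  \<open>(\<pi> r p)\<^sup>g / g!\<close> of a ball. If \<open>(\<pi> r)\<^sup>g < 4 g!\<close> and \<open>p\<close> is large, the mean number
  of short vectors is therefore less than four. As short vectors come in fours, some lattice of
  the family has none (\<open>exists_without_short_solution\<close>), and the constant is at least \<open>r\<close>.

  The constant is a supremum of real numbers, so it dominates these minima only if they are bounded
  above on the whole Siegel space. This is a Hermite type induction
  (\<open>symplectic_lattice_short_vector\<close>): for an almost shortest vector \<open>v\<close>, the vectors of the lattice
  that are symplectically orthogonal to \<open>v\<close> project onto a symplectic lattice of smaller
  dimension in the orthogonal complement of \<open>v\<close>, and a short vector there lifts to one whose
  component along \<open>v\<close> is at most \<open>v / 2\<close>. To apply it to the lattice of \<open>Z\<close> one needs that the matrix
  is symplectic, hence that the square roots in it exist, are unique and are inverse to each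
  other; this rests on the spectral theorem for real symmetric matrices.
\<close>

section \<open>The spectral theorem and positive definite square roots\<close>

lemma symmetric_mat_inner:
  fixes A :: "real^'n^'n"
  assumes "transpose A = A"
  shows "x \<bullet> (A *v y) = (A *v x) \<bullet> y"
  by (metis assms dot_lmul_matrix transpose_matrix_vector)

text \<open>
  The unit vector of the subspace that maximises the quadratic form is an eigenvector: its
  residual \<open>A v - c v\<close> is orthogonal to \<open>v\<close>, and moving from \<open>v\<close> in the direction of the residual
  would increase the Rayleigh quotient to first order.
\<close>

lemma eigenvector_in_invariant_subspace:
  fixes A :: "real^'n^'n"
  assumes sym: "transpose A = A" and V: "subspace V" and nz: "w \<in> V" "w \<noteq> 0"
    and inv: "\<And>v. v \<in> V \<Longrightarrow> A *v v \<in> V"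
  obtains v c where "v \<in> V" "norm v = 1" "A *v v = c *\<^sub>R v"
proof -
  let ?S = "V \<inter> sphere 0 1"
  have "compact ?S"
    by (simp add: V closed_Int_compact closed_subspace)
  moreover have "(1 / norm w) *\<^sub>R w \<in> ?S"
    using nz V by (simp add: subspace_scale)
  then have "?S \<noteq> {}" by blast
  moreover have "continuous_on ?S (\<lambda>v. v \<bullet> (A *v v))"
    by (intro continuous_intros linear_continuous_on linear_conv_bounded_linear[THEN iffD1])
       (simp add: matrix_vector_mul_linear)
  ultimately obtain v where v: "v \<in> V" "norm v = 1"
    and max: "\<And>y. y \<in> V \<Longrightarrow> norm y = 1 \<Longrightarrow> y \<bullet> (A *v y) \<le> v \<bullet> (A *v v)"
    using continuous_attains_sup[of ?S "\<lambda>v. v \<bullet> (A *v v)"]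
    by (metis IntE IntI mem_sphere_0)
  define c where "c = v \<bullet> (A *v v)"
  have vv: "v \<bullet> v = 1"
    using v by (simp add: dot_square_norm)
  have le: "y \<bullet> (A *v y) \<le> c * (y \<bullet> y)" if "y \<in> V" for y
  proof (cases "y = 0")
    case False
    let ?y = "(1 / norm y) *\<^sub>R y"
    have "?y \<bullet> (A *v ?y) \<le> c"
      unfolding c_def using that False V by (intro max) (auto simp: subspace_scale)
    then have "(y \<bullet> (A *v y)) / (norm y)\<^sup>2 \<le> c"
      by (simp add: matrix_vector_mult_scaleR power2_eq_square)
    then show ?thesis
      using False by (simp add: divide_le_eq dot_square_norm)
  qed simp
  define r where "r = A *v v - c *\<^sub>R v"
  have rV: "r \<in> V"
    using v V inv by (simp add: r_def subspace_diff subspace_scale)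
  have rv: "r \<bullet> v = 0"
    by (simp add: r_def inner_diff_left vv c_def inner_commute[of "A *v v" v])
  have Avr: "r \<bullet> (A *v v) = r \<bullet> r" and Arv: "v \<bullet> (A *v r) = r \<bullet> r"
    using symmetric_mat_inner[OF sym, of v r] rv
    by (simp_all add: r_def inner_diff_right inner_diff_left inner_commute)
  \<comment> \<open>first variation at the maximum in the direction of the residual\<close>
  have "2 * t * (r \<bullet> r) \<le> t\<^sup>2 * (c * (r \<bullet> r) - r \<bullet> (A *v r))" for t
  proof -
    have "v + t *\<^sub>R r \<in> V"
      using v rV V by (simp add: subspace_add subspace_scale)
    from le[OF this] have
      "v \<bullet> (A *v v) + t * (v \<bullet> (A *v r)) + t * (r \<bullet> (A *v v)) + t * t * (r \<bullet> (A *v r))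
        \<le> c * (v \<bullet> v + 2 * t * (r \<bullet> v) + t * t * (r \<bullet> r))"
      by (simp add: matrix_vector_right_distrib matrix_vector_mult_scaleR inner_add_left
          inner_add_right inner_commute algebra_simps)
    then show ?thesis
      by (simp add: Avr Arv vv rv c_def[symmetric] power2_eq_square algebra_simps)
  qed
  note var = this
  have "r \<bullet> r = 0"
  proof (rule ccontr)
    assume "r \<bullet> r \<noteq> 0"
    then have pos: "r \<bullet> r > 0" by (simp add: less_le)
    \<comment> \<open>for small \<open>t\<close> the linear term dominates; this \<open>t\<close> makes the quadratic one at most half of it\<close>
    define K where "K = \<bar>c * (r \<bullet> r) - r \<bullet> (A *v r)\<bar> + 1"
    have K: "K > 0" "c * (r \<bullet> r) - r \<bullet> (A *v r) \<le> K" by (auto simp: K_def)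
    define t where "t = (r \<bullet> r) / K"
    have t: "t > 0" using pos K by (simp add: t_def)
    have "2 * t * (r \<bullet> r) \<le> t\<^sup>2 * K"
      using var[of t] K(2) by (meson mult_left_mono order_trans zero_le_power2)
    then have "2 * (r \<bullet> r) \<le> t * K" using t by (simp add: power2_eq_square)
    then show False using pos K by (simp add: t_def)
  qed
  then have "A *v v = c *\<^sub>R v" by (simp add: r_def)
  with v that show thesis by blast
qed

text \<open>
  An orthonormal set of eigenvectors of maximal size spans, because its orthogonal complement is
  invariant and would otherwise contain one more eigenvector.
\<close>

lemma orthonormal_eigenbasis:
  fixes A :: "real^'n^'n"
  assumes sym: "transpose A = A"
  obtains B l where "finite B" "pairwise orthogonal B" "\<And>b. b \<in> B \<Longrightarrow> norm b = 1"
    "\<And>b. b \<in> B \<Longrightarrow> A *v b = l b *\<^sub>R b" "span B = UNIV"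
proof -
  define P where "P = (\<lambda>B. pairwise orthogonal B \<and> (\<forall>b\<in>B. norm b = 1 \<and> (\<exists>c. A *v b = c *\<^sub>R b)))"
  have indep: "finite B \<and> card B \<le> CARD('n)" if "P B" for B
  proof -
    have "independent B"
      using that unfolding P_def by (intro pairwise_orthogonal_independent) auto
    then show ?thesis using independent_bound by force
  qed
  have "P {}" by (simp add: P_def)
  then obtain B where B: "P B" and max: "\<And>B'. P B' \<Longrightarrow> card B' \<le> card B"
    using ex_has_greatest_nat[of P "{}" card "Suc CARD('n)"] indep by (metis le_imp_less_Suc)
  have "span B = UNIV"
  proof (rule ccontr)
    assume "span B \<noteq> UNIV"
    then obtain a where a: "a \<noteq> 0" "\<And>x. x \<in> span B \<Longrightarrow> a \<bullet> x = 0"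
      using span_not_UNIV_orthogonal by blast
    let ?V = "{v. \<forall>b\<in>B. v \<bullet> b = 0}"
    have "subspace ?V"
      by (auto simp: subspace_def inner_add_left)
    moreover have "a \<in> ?V" using a(2) span_base by blast
    moreover have "A *v v \<in> ?V" if "v \<in> ?V" for v
    proof (clarify)
      fix b assume b: "b \<in> B"
      then obtain c where "A *v b = c *\<^sub>R b" using B by (auto simp: P_def)
      then show "(A *v v) \<bullet> b = 0"
        using that b by (simp flip: symmetric_mat_inner[OF sym])
    qed
    ultimately obtain v c where v: "v \<in> ?V" "norm v = 1" "A *v v = c *\<^sub>R v"
      using a(1) by (rule_tac eigenvector_in_invariant_subspace[OF sym, of ?V a])
    have "P (insert v B)"
      using v B unfolding P_def by (auto simp: pairwise_insert orthogonal_def inner_commute)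
    moreover have "v \<notin> B" using v by force
    ultimately show False using max[of "insert v B"] indep[OF B] by simp
  qed
  moreover obtain l where "\<And>b. b \<in> B \<Longrightarrow> A *v b = l b *\<^sub>R b"
    using B unfolding P_def by metis
  ultimately show thesis
    using that[of B l] B indep[OF B] by (simp add: P_def)
qed

lemma pos_def_sqrt_exists:
  fixes A :: "real^'n^'n"
  assumes sym: "transpose A = A" and pos: "pos_def_mat A"
  shows "\<exists>B. transpose B = B \<and> pos_def_mat B \<and> B ** B = A"
proof -
  obtain E l where E: "finite E" "pairwise orthogonal E" "\<And>b. b \<in> E \<Longrightarrow> norm b = 1"
    "\<And>b. b \<in> E \<Longrightarrow> A *v b = l b *\<^sub>R b" "span E = UNIV"
    using orthonormal_eigenbasis[OF sym] by metis
  have l_pos: "l b > 0" if "b \<in> E" for b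
  proof -
    have "b \<noteq> 0" using E(3)[OF that] by auto
    then have "b \<bullet> (A *v b) > 0" using pos by (auto simp: pos_def_mat_def)
    moreover have "b \<bullet> b = 1" using E(3)[OF that] by (simp add: dot_square_norm)
    ultimately show ?thesis using E(4)[OF that] by simp
  qed
  have expand: "(\<Sum>b\<in>E. (x \<bullet> b) *\<^sub>R b) = x" for x
    using orthonormal_basis_expand[of E x] E by auto
  \<comment> \<open>the same eigenvectors, with the roots of the eigenvalues\<close>
  define B :: "real^'n^'n" where "B = (\<chi> i k. \<Sum>b\<in>E. sqrt (l b) * b $ i * b $ k)"
  have Bv: "B *v v = (\<Sum>b\<in>E. (sqrt (l b) * (v \<bullet> b)) *\<^sub>R b)" for v
  proof -
    have "(\<Sum>k\<in>UNIV. (\<Sum>b\<in>E. sqrt (l b) * b $ i * b $ k) * v $ k)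
        = (\<Sum>b\<in>E. sqrt (l b) * (\<Sum>k\<in>UNIV. v $ k * b $ k) * b $ i)" for i
      unfolding sum_distrib_right sum_distrib_left
      by (subst sum.swap) (intro sum.cong refl, simp)
    then show ?thesis
      by (simp add: vec_eq_iff B_def matrix_vector_mult_def inner_vec_def)
  qed
  have symB: "transpose B = B"
    by (simp add: B_def transpose_def vec_eq_iff mult.assoc) (simp add: mult.commute)
  have "pos_def_mat B"
    unfolding pos_def_mat_def
  proof (intro allI impI)
    fix v :: "real^'n" assume "v \<noteq> 0"
    then obtain b where b: "b \<in> E" "v \<bullet> b \<noteq> 0"
      using expand[of v] by (metis (no_types, lifting) scaleR_zero_left sum.neutral)
    have "0 < (\<Sum>b\<in>E. sqrt (l b) * (v \<bullet> b)\<^sup>2)"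
      using b E(1) l_pos by (intro sum_pos2[of _ b]) (auto simp: less_imp_le)
    also have "\<dots> = v \<bullet> (B *v v)"
      by (simp add: Bv inner_sum_right power2_eq_square mult.assoc)
    finally show "v \<bullet> (B *v v) > 0" .
  qed
  moreover have "B ** B = A"
  proof -
    have Bb: "B *v b = sqrt (l b) *\<^sub>R b" if "b \<in> E" for b
    proof -
      have "(sqrt (l b') * (b \<bullet> b')) *\<^sub>R b' = (if b' = b then sqrt (l b) *\<^sub>R b else 0)"
        if "b' \<in> E" for b'
        using E(2) E(3)[OF \<open>b \<in> E\<close>] that \<open>b \<in> E\<close>
        by (auto simp: pairwise_def orthogonal_def dot_square_norm)
      then show ?thesis using that E(1) by (simp add: Bv)
    qed
    have "(B ** B) *v b = A *v b" if "b \<in> E" for b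
      using Bb[OF that] E(4)[OF that] l_pos[OF that]
      by (simp add: matrix_vector_mul_assoc[symmetric] matrix_vector_mult_scaleR)
    then have "(*v) (B ** B) = (*v) A"
      using linear_eq_on_span[of "(*v) (B ** B)" "(*v) A" E] E(5)
      by (auto simp: matrix_vector_mul_linear)
    then show ?thesis by (metis matrix_of_matrix_vector_mul)
  qed
  ultimately show ?thesis using symB by blast
qed

text \<open>
  If \<open>B\<^sup>2 = C\<^sup>2\<close> and \<open>(B - C) b = l b\<close>, then comparing \<open>|B b|\<^sup>2\<close> with \<open>|C b|\<^sup>2\<close> gives
  \<open>l (b \<bullet> B b + b \<bullet> C b) = 0\<close>. So all eigenvalues of the symmetric matrix \<open>B - C\<close> vanish.
\<close>

lemma pos_def_sqrt_unique:
  fixes B C :: "real^'n^'n"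
  assumes B: "transpose B = B" "pos_def_mat B" and C: "transpose C = C" "pos_def_mat C"
    and eq: "B ** B = C ** C"
  shows "B = C"
proof -
  have "transpose (B - C) = B - C"
    using B(1) C(1) by (simp add: transpose_def vec_eq_iff)
  then obtain E l where E: "finite E" "pairwise orthogonal E" "\<And>b. b \<in> E \<Longrightarrow> norm b = 1"
    "\<And>b. b \<in> E \<Longrightarrow> (B - C) *v b = l b *\<^sub>R b" "span E = UNIV"
    using orthonormal_eigenbasis by metis
  have "B *v b = C *v b" if b: "b \<in> E" for b
  proof -
    have D: "B *v b = C *v b + l b *\<^sub>R b"
      using E(4)[OF b] by (simp add: matrix_vector_mult_diff_rdistrib algebra_simps)
    have "(B *v b) \<bullet> (B *v b) = (C *v b) \<bullet> (C *v b)"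
      using arg_cong[OF eq, of "\<lambda>M. b \<bullet> (M *v b)"]
      by (simp add: matrix_vector_mul_assoc[symmetric] symmetric_mat_inner B(1) C(1))
    then have "l b * (b \<bullet> (B *v b) + b \<bullet> (C *v b)) = 0"
      by (simp add: D inner_add_left inner_add_right inner_commute algebra_simps)
    moreover have "b \<noteq> 0" using E(3)[OF b] by auto
    then have "b \<bullet> (B *v b) + b \<bullet> (C *v b) > 0"
      using B(2) C(2) by (auto simp: pos_def_mat_def add_pos_pos)
    ultimately show ?thesis by (simp add: D)
  qed
  then have "(*v) B = (*v) C"
    using linear_eq_on_span[of "(*v) B" "(*v) C" E] E(5)
    by (auto simp: matrix_vector_mul_linear)
  then show ?thesis by (metis matrix_of_matrix_vector_mul)
qed

lemma mat_sqrt_eqI: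
  assumes "transpose B = B" "pos_def_mat B" "B ** B = A"
  shows "mat_sqrt A = B"
  unfolding mat_sqrt_def using assms pos_def_sqrt_unique by (intro the_equality) blast+

lemma mat_sqrt:
  assumes "transpose A = A" "pos_def_mat A"
  shows "transpose (mat_sqrt A) = mat_sqrt A" "pos_def_mat (mat_sqrt A)"
    "mat_sqrt A ** mat_sqrt A = A"
  using pos_def_sqrt_exists[OF assms] mat_sqrt_eqI by metis+

lemma pos_def_imp_invertible:
  fixes A :: "real^'n^'n"
  assumes "pos_def_mat A"
  shows "invertible A"
proof -
  have "x = 0" if "A *v x = 0" for x
    using assms that by (auto simp: pos_def_mat_def dest!: spec[of _ x])
  then show ?thesis
    by (metis invertible_left_inverse matrix_left_invertible_ker)
qed

lemma matrix_inv_mult: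
  fixes A :: "real^'n^'n"
  assumes "invertible A"
  shows "A ** matrix_inv A = mat 1" "matrix_inv A ** A = mat 1"
  using someI_ex[OF assms[unfolded invertible_def]] by (simp_all add: matrix_inv_def)

lemma matrix_inv_eqI:
  fixes A B :: "real^'n^'n"
  assumes "A ** B = mat 1"
  shows "matrix_inv A = B"
proof -
  have "invertible A" using assms by (auto simp: invertible_right_inverse)
  then have "matrix_inv A ** (A ** B) = B"
    by (simp add: matrix_mul_assoc matrix_inv_mult)
  then show ?thesis by (simp add: assms)
qed

lemma mat_sqrt_matrix_inv:
  fixes A :: "real^'n^'n"
  assumes A: "transpose A = A" "pos_def_mat A"
  shows "mat_sqrt (matrix_inv A) ** mat_sqrt A = mat 1"
    and "mat_sqrt A ** mat_sqrt (matrix_inv A) = mat 1"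
    and "transpose (mat_sqrt (matrix_inv A)) = mat_sqrt (matrix_inv A)"
proof -
  define t where "t = mat_sqrt A"
  note t = mat_sqrt[OF A, folded t_def]
  have "invertible t" using t(2) by (rule pos_def_imp_invertible)
  define s where "s = matrix_inv t"
  have st: "s ** t = mat 1" and ts: "t ** s = mat 1"
    unfolding s_def using \<open>invertible t\<close> by (simp_all add: matrix_inv_mult)
  have sym: "transpose s = s"
    by (metis matrix_mul_assoc matrix_mul_lid matrix_mul_rid matrix_transpose_mul st t(1) transpose_mat ts)
  have "pos_def_mat s"
    unfolding pos_def_mat_def
  proof (intro allI impI)
    fix v :: "real^'n" assume "v \<noteq> 0"
    have v: "t *v (s *v v) = v" by (simp add: matrix_vector_mul_assoc ts)
    then have "s *v v \<noteq> 0" using \<open>v \<noteq> 0\<close> by auto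
    then have "(s *v v) \<bullet> (t *v (s *v v)) > 0" using t(2) by (auto simp: pos_def_mat_def)
    then show "v \<bullet> (s *v v) > 0" by (simp add: v inner_commute)
  qed
  moreover have "s ** s = matrix_inv A"
  proof -
    have "A ** (s ** s) = mat 1"
      by (metis matrix_mul_assoc matrix_mul_rid t(3) ts)
    then show ?thesis by (simp add: matrix_inv_eqI)
  qed
  ultimately have "mat_sqrt (matrix_inv A) = s"
    using sym by (intro mat_sqrt_eqI)
  then show "mat_sqrt (matrix_inv A) ** mat_sqrt A = mat 1"
    and "mat_sqrt A ** mat_sqrt (matrix_inv A) = mat 1"
    and "transpose (mat_sqrt (matrix_inv A)) = mat_sqrt (matrix_inv A)"
    using st ts sym by (simp_all add: t_def)
qed

section \<open>Short vectors in symplectic lattices\<close>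

text \<open>
  An almost minimal element stands in for a shortest vector. If there is none, then the infimum is 0.
\<close>

lemma almost_minimal_or_arbitrarily_small:
  fixes f :: "'a \<Rightarrow> real"
  assumes "S \<noteq> {}" "\<And>x. x \<in> S \<Longrightarrow> f x > 0" "e > 0"
  shows "(\<exists>v\<in>S. \<forall>x\<in>S. f v \<le> 2 * f x) \<or> (\<exists>x\<in>S. f x \<le> e)"
proof (cases "(INF x\<in>S. f x) > 0")
  case True
  have bdd: "bdd_below (f ` S)"
    using assms(2) by (intro bdd_belowI2[of _ 0]) (simp add: less_imp_le)
  have "(INF x\<in>S. f x) < 2 * (INF x\<in>S. f x)" using True by simp
  then obtain v where v: "v \<in> S" "f v < 2 * (INF x\<in>S. f x)"
    using cINF_less_iff[OF assms(1) bdd] by blast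
  have "f v \<le> 2 * f x" if "x \<in> S" for x
    using v(2) cINF_lower[OF bdd that] by linarith
  with v(1) show ?thesis by blast
next
  case False
  have bdd: "bdd_below (f ` S)"
    using assms(2) by (intro bdd_belowI2[of _ 0]) (simp add: less_imp_le)
  have "(INF x\<in>S. f x) < e" using False assms(3) by simp
  then show ?thesis
    using cINF_less_iff[OF assms(1) bdd] by (meson less_imp_le)
qed

text \<open>
  A lattice that is unimodular for the symplectic form \<open>x \<bullet> J y\<close> of a complex structure \<open>J\<close>, stated
  without bases: the form is integral and every additive map from the lattice to the integers is
  represented by a lattice vector. In this form the notion passes easily to sublattice quotients,
  which is what the induction on the dimension needs. The ambient space may be larger
  than the span, as long as the span is \<open>J\<close>-invariant.
\<close>

locale symplectic_lattice =
  fixes J :: "'a::euclidean_space \<Rightarrow> 'a" and L :: "'a set"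
  assumes J_linear: "linear J"
    and J_J: "J (J x) = - x"
    and J_inner: "J x \<bullet> J y = x \<bullet> y"
    and L_zero: "0 \<in> L"
    and L_diff: "x \<in> L \<Longrightarrow> y \<in> L \<Longrightarrow> x - y \<in> L"
    and L_int: "x \<in> L \<Longrightarrow> y \<in> L \<Longrightarrow> x \<bullet> J y \<in> \<int>"
    and J_span: "x \<in> L \<Longrightarrow> J x \<in> span L"
    and unimodular: "(\<And>x. x \<in> L \<Longrightarrow> \<phi> x \<in> \<int>) \<Longrightarrow>
      (\<And>x y. x \<in> L \<Longrightarrow> y \<in> L \<Longrightarrow> \<phi> (x - y) = \<phi> x - \<phi> y) \<Longrightarrow>
      \<exists>u\<in>L. \<forall>x\<in>L. \<phi> x = u \<bullet> J x"
begin

lemmas J_add = linear_add[OF J_linear] and J_diff = linear_diff[OF J_linear]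
  and J_scale = linear_scale[OF J_linear]

lemma J_skew: "x \<bullet> J y = - (J x \<bullet> y)"
  using J_inner[of x "J y"] by (simp add: J_J)

lemma J_self [simp]: "x \<bullet> J x = 0"
  using J_skew[of x x] by (simp add: inner_commute)

lemma J_zero [simp]: "J 0 = 0"
  using linear_0[OF J_linear] .

lemma L_uminus: "x \<in> L \<Longrightarrow> - x \<in> L"
  using L_diff[OF L_zero] by force

lemma L_add: "x \<in> L \<Longrightarrow> y \<in> L \<Longrightarrow> x + y \<in> L"
  using L_diff[of x "- y"] L_uminus[of y] by simp

lemma L_int_scale: "x \<in> L \<Longrightarrow> of_int m *\<^sub>R x \<in> L"
proof -
  assume x: "x \<in> L"
  have nat: "real n *\<^sub>R x \<in> L" for n
    by (induction n) (auto simp: L_zero x algebra_simps intro: L_add)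
  show ?thesis
    using nat[of "nat m"] L_uminus[OF nat[of "nat (- m)"]] by (cases "m \<ge> 0") auto
qed

lemma nondegenerate:
  assumes v: "v \<in> L" and 0: "\<And>x. x \<in> L \<Longrightarrow> v \<bullet> J x = 0"
  shows "v = 0"
proof -
  have "subspace {x. v \<bullet> J x = 0}"
    by (auto simp: subspace_def J_add J_scale inner_add_right)
  then have "span L \<subseteq> {x. v \<bullet> J x = 0}"
    using 0 by (intro span_minimal) auto
  then have "v \<bullet> J (J v) = 0" using J_span[OF v] by auto
  then show ?thesis by (simp add: J_J)
qed

text \<open>
  The values \<open>v \<bullet> J w\<close> form a group \<open>d \<int>\<close>. By unimodularity \<open>v / d\<close> is again a lattice vector, so
  almost minimality of \<open>v\<close> forces \<open>d = 1\<close>.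
\<close>

lemma dual_vector_exists:
  assumes v: "v \<in> L" "v \<noteq> 0" and min: "\<And>x. x \<in> L \<Longrightarrow> x \<noteq> 0 \<Longrightarrow> v \<bullet> v \<le> 2 * (x \<bullet> x)"
  obtains w where "w \<in> L" "v \<bullet> J w = 1"
proof -
  obtain x0 where x0: "x0 \<in> L" "v \<bullet> J x0 \<noteq> 0" using nondegenerate v by blast
  define P where "P = (\<lambda>d::nat. d > 0 \<and> (\<exists>w\<in>L. v \<bullet> J w = real d))"
  have "\<exists>d. P d"
  proof -
    obtain k :: int where k: "v \<bullet> J x0 = of_int k" using L_int[OF v(1) x0(1)] by (auto elim: Ints_cases)
    have "v \<bullet> J (- x0) = of_int (- k)" using k J_diff[of 0 x0] by simp
    then have "P (nat \<bar>k\<bar>)"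
      using k x0 L_uminus[OF x0(1)] unfolding P_def by (cases "k > 0") auto
    then show ?thesis ..
  qed
  then have "P (LEAST d. P d)" by (rule LeastI_ex)
  then obtain d where d: "P d" and least: "\<And>e. P e \<Longrightarrow> d \<le> e"
    by (metis Least_le)
  obtain w where w: "w \<in> L" "v \<bullet> J w = real d" and d0: "d > 0" using d by (auto simp: P_def)
  have div: "(v \<bullet> J x) / real d \<in> \<int>" if x: "x \<in> L" for x
  proof -
    obtain k :: int where k: "v \<bullet> J x = of_int k" using L_int[OF v(1) x] by (auto elim: Ints_cases)
    define r where "r = k mod int d"
    have r: "0 \<le> r" "r < int d" using d0 by (auto simp: r_def)
    have "of_int k = of_int (k div int d) * real d + of_int r"
      unfolding r_def by (metis div_mult_mod_eq of_int_add of_int_mult of_int_of_nat_eq)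
    moreover have "x - of_int (k div int d) *\<^sub>R w \<in> L"
      using x w L_int_scale L_diff by blast
    moreover have "v \<bullet> J (x - of_int (k div int d) *\<^sub>R w) = of_int k - of_int (k div int d) * real d"
      using k w by (simp add: J_diff J_scale inner_diff_right)
    ultimately have "r > 0 \<Longrightarrow> P (nat r)"
      using r unfolding P_def by auto
    then have "r = 0" using least[of "nat r"] r by force
    then have "of_int k = of_int (k div int d) * real d"
      by (metis r_def add.right_neutral div_mult_mod_eq of_int_mult of_int_of_nat_eq)
    then show ?thesis using d0 k by simp
  qed
  have "\<exists>u\<in>L. \<forall>x\<in>L. (v \<bullet> J x) / real d = u \<bullet> J x"
    by (intro unimodular div) (auto simp: J_diff inner_diff_right diff_divide_distrib)
  then obtain u where u: "u \<in> L" "\<And>x. x \<in> L \<Longrightarrow> (v \<bullet> J x) / real d = u \<bullet> J x" by blast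
  have "v - of_int (int d) *\<^sub>R u = 0"
  proof (rule nondegenerate)
    show "v - of_int (int d) *\<^sub>R u \<in> L" using v u L_int_scale L_diff by blast
    show "(v - of_int (int d) *\<^sub>R u) \<bullet> J x = 0" if "x \<in> L" for x
      using u(2)[OF that] d0 by (simp add: inner_diff_left field_simps)
  qed
  then have vu: "v = real d *\<^sub>R u" by simp
  then have "u \<noteq> 0" using v by auto
  then have "real d * real d * (u \<bullet> u) \<le> 2 * (u \<bullet> u)"
    using min[OF u(1)] by (simp add: vu)
  then have dd: "real d * real d \<le> 2" using \<open>u \<noteq> 0\<close> by simp
  have "d < 2"
  proof (rule ccontr)
    assume "\<not> d < 2"
    then have "2 * 2 \<le> real d * real d" by (intro mult_mono) auto
    with dd show False by simp
  qed
  then have "d = 1" using d0 by simp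
  with w that show thesis by simp
qed

end

text \<open>
  Let \<open>v\<close> be almost shortest, \<open>w\<close> dual to \<open>v\<close>, \<open>K\<close> the vectors symplectically orthogonal to \<open>v\<close> and \<open>p\<close>
  the orthogonal projection along \<open>v\<close>. Then \<open>p K\<close> is again a symplectic lattice. A vector of
  squared length at most \<open>c\<close> in it lifts to one of squared length at most \<open>c + |v|\<^sup>2 / 4\<close>, and
  \<open>|v|\<^sup>2 \<le> 2 (c + |v|\<^sup>2 / 4)\<close> gives \<open>|v|\<^sup>2 \<le> 4 c\<close>. If \<open>p K\<close> is trivial, the lattice has rank two and
  \<open>w\<close> takes the role of the lifted vector.
\<close>

lemma symplectic_lattice_short_vector:
  fixes J :: "'a::euclidean_space \<Rightarrow> 'a"
  assumes "symplectic_lattice J L" "L \<noteq> {0}"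
  shows "\<exists>x\<in>L. x \<noteq> 0 \<and> x \<bullet> x \<le> 2 * 4 ^ dim L"
  using assms
proof (induction "dim L" arbitrary: L rule: less_induct)
  case less
  interpret symplectic_lattice J L by fact
  have "L - {0} \<noteq> {}" using less.prems(2) L_zero by blast
  then consider v where "v \<in> L" "v \<noteq> 0" "\<And>x. x \<in> L \<Longrightarrow> x \<noteq> 0 \<Longrightarrow> v \<bullet> v \<le> 2 * (x \<bullet> x)"
    | x where "x \<in> L" "x \<noteq> 0" "x \<bullet> x \<le> 1"
    using almost_minimal_or_arbitrarily_small[of "L - {0}" "\<lambda>x. x \<bullet> x" 1] by auto
  then show ?case
  proof cases
    case 2
    have "(1::real) \<le> 4 ^ dim L" by (rule one_le_power) simp
    then have "(1::real) \<le> 2 * 4 ^ dim L" by linarith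
    with 2 show ?thesis by (meson order_trans)
  next
    case 1
    note v = 1(1,2) and min = 1(3)
    obtain w where w: "w \<in> L" "v \<bullet> J w = 1" using dual_vector_exists[OF v min] by blast
    have vv: "v \<bullet> v > 0" using v by simp
    define p where "p x = x - ((x \<bullet> v) / (v \<bullet> v)) *\<^sub>R v" for x
    define K where "K = {x \<in> L. v \<bullet> J x = 0}"
    have p_linear: "linear p"
      by (auto simp: p_def linear_iff inner_add_left algebra_simps add_divide_distrib)
    have p_diff: "p (x - y) = p x - p y" for x y using linear_diff[OF p_linear] .
    have p_v: "p v = 0" using vv by (simp add: p_def)
    have pv0: "p x \<bullet> v = 0" for x using vv by (simp add: p_def inner_diff_left)
    have p_id: "p x = x" if "x \<bullet> v = 0" for x using that by (simp add: p_def)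
    have p_omega: "p x \<bullet> J (p y) = x \<bullet> J y" if "v \<bullet> J x = 0" "v \<bullet> J y = 0" for x y
      using that J_skew[of x v] by (simp add: p_def J_diff J_scale inner_diff_left inner_diff_right inner_commute)
    have K_proj: "x - (v \<bullet> J x) *\<^sub>R w \<in> K" if x: "x \<in> L" for x
    proof -
      obtain k :: int where k: "v \<bullet> J x = of_int k" using L_int[OF v(1) x] by (auto elim: Ints_cases)
      then show ?thesis
        using x w L_int_scale L_diff by (simp add: K_def J_diff J_scale inner_diff_right)
    qed
    have K_span: "y \<in> span K" if y: "y \<in> span L" "v \<bullet> J y = 0" for y
    proof -
      define h where "h x = x - (v \<bullet> J x) *\<^sub>R w" for x
      have "linear h"
        by (auto simp: h_def linear_iff J_add J_scale inner_add_right algebra_simps)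
      then have "h ` span L \<subseteq> span K"
        using K_proj by (simp flip: linear_span_image) (intro span_mono, auto simp: h_def)
      then show ?thesis using y by (auto simp: h_def dest!: subsetD[of "h ` span L"])
    qed
    have round: "\<exists>m::int. (x - of_int m *\<^sub>R v) \<bullet> (x - of_int m *\<^sub>R v) \<le> p x \<bullet> p x + (v \<bullet> v) / 4" for x
    proof -
      define a where "a = (x \<bullet> v) / (v \<bullet> v)"
      define m where "m = round a"
      have "\<bar>a - of_int m\<bar> \<le> 1 / 2" using of_int_round_abs_le[of a] by (simp add: m_def abs_minus_commute)
      then have "(a - of_int m)\<^sup>2 \<le> (1 / 2)\<^sup>2" by (metis abs_ge_zero power2_abs power_mono)
      then have "(a - of_int m)\<^sup>2 * (v \<bullet> v) \<le> (1 / 4) * (v \<bullet> v)"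
        using vv by (intro mult_right_mono) (auto simp: power2_eq_square)
      moreover have "x - of_int m *\<^sub>R v = p x + (a - of_int m) *\<^sub>R v"
        by (simp add: p_def a_def algebra_simps)
      then have "(x - of_int m *\<^sub>R v) \<bullet> (x - of_int m *\<^sub>R v) = p x \<bullet> p x + (a - of_int m)\<^sup>2 * (v \<bullet> v)"
        using pv0[of x] by (simp add: inner_add_left inner_add_right inner_commute power2_eq_square)
      ultimately show ?thesis by (intro exI[of _ m]) simp
    qed
    show ?thesis
    proof (cases "p ` K = {0}")
      case True
      \<comment> \<open>so \<open>w\<close> is \<open>- J v / |v|\<^sup>2\<close> plus a multiple of \<open>v\<close>\<close>
      have "J v + (v \<bullet> v) *\<^sub>R w \<in> span K"
        using J_span[OF v(1)] w vv
        by (intro K_span span_add span_scale) (auto simp: span_base J_add J_scale J_J inner_add_right inner_diff_right)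
      moreover have "p ` span K = {0}"
        using True by (simp flip: linear_span_image[OF p_linear])
      ultimately have "p (J v + (v \<bullet> v) *\<^sub>R w) = 0" by blast
      moreover have "p (J v) = J v" by (intro p_id) (simp add: inner_commute)
      ultimately have "(v \<bullet> v) *\<^sub>R p w = - J v"
        by (simp add: linear_add[OF p_linear] linear_scale[OF p_linear] eq_neg_iff_add_eq_0 add.commute)
      then have "((v \<bullet> v) *\<^sub>R p w) \<bullet> ((v \<bullet> v) *\<^sub>R p w) = v \<bullet> v"
        by (simp add: J_inner)
      then have pw: "p w \<bullet> p w = 1 / (v \<bullet> v)"
        using vv by (simp add: field_simps)
      obtain m :: int where m: "(w - of_int m *\<^sub>R v) \<bullet> (w - of_int m *\<^sub>R v) \<le> 1 / (v \<bullet> v) + (v \<bullet> v) / 4"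
        using round[of w] pw by auto
      have "v \<bullet> J (w - of_int m *\<^sub>R v) = 1" using w by (simp add: J_diff J_scale inner_diff_right)
      then have "w - of_int m *\<^sub>R v \<noteq> 0" by (metis J_zero inner_zero_right zero_neq_one)
      moreover have "w - of_int m *\<^sub>R v \<in> L" using w v L_diff L_int_scale by blast
      ultimately have "v \<bullet> v \<le> 2 * (1 / (v \<bullet> v) + (v \<bullet> v) / 4)"
        using min m by fastforce
      then have "(v \<bullet> v) * (v \<bullet> v) \<le> 2\<^sup>2" using vv by (simp add: field_simps)
      then have "v \<bullet> v \<le> 2" by (metis power2_eq_square power2_le_imp_le zero_le_numeral)
      moreover have "(1::real) \<le> 4 ^ dim L" by (rule one_le_power) simp
      then have "(2::real) \<le> 2 * 4 ^ dim L" by linarith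
      ultimately show ?thesis using v by (meson order_trans)
    next
      case False
      have K_L: "K \<subseteq> L" by (auto simp: K_def)
      have pK_span: "p x \<in> span L" if "x \<in> L" for x
        unfolding p_def using that v by (intro span_diff span_scale span_base)
      have "dim (p ` K) < dim L"
      proof (rule dim_psubset)
        have "span (p ` K) \<subseteq> span L"
          using pK_span K_L by (intro span_minimal) auto
        moreover have "span (p ` K) \<subseteq> {x. x \<bullet> v = 0}"
          by (intro span_minimal) (auto simp: pv0 subspace_def inner_add_left)
        ultimately show "span (p ` K) \<subset> span L"
          using v vv span_base[OF v(1)] by fastforce
      qed
      moreover have "symplectic_lattice J (p ` K)"
      proof (rule symplectic_lattice.intro)
        show "linear J" by (rule J_linear)
        show "J (J x) = - x" for x by (rule J_J)
        show "J x \<bullet> J y = x \<bullet> y" for x y by (rule J_inner)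
        have K0: "0 \<in> K" by (simp add: K_def L_zero)
        show "0 \<in> p ` K" using K0 linear_0[OF p_linear] by (metis imageI)
        have K_diff: "x - y \<in> K" if "x \<in> K" "y \<in> K" for x y
          using that L_diff by (auto simp: K_def J_diff inner_diff_right)
        show "x - y \<in> p ` K" if "x \<in> p ` K" "y \<in> p ` K" for x y
          using that K_diff by (auto simp flip: p_diff)
        show "x \<bullet> J y \<in> \<int>" if "x \<in> p ` K" "y \<in> p ` K" for x y
          using that L_int by (auto simp: K_def p_omega)
        show "J y \<in> span (p ` K)" if y: "y \<in> p ` K" for y
        proof -
          obtain x where x: "x \<in> L" "v \<bullet> J x = 0" "y = p x" using y by (auto simp: K_def)
          have "J ` span L \<subseteq> span L"
            using J_span by (simp flip: linear_span_image[OF J_linear]) (intro span_minimal, auto)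
          then have "J y \<in> span L" using pK_span[OF x(1)] x(3) by blast
          moreover have "v \<bullet> J (J y) = 0" using pv0[of x] x by (simp add: J_J inner_commute)
          ultimately have "J y \<in> span K" by (rule K_span)
          moreover have "p (J y) = J y"
            by (intro p_id) (simp add: x p_def J_diff J_scale inner_diff_right inner_commute)
          ultimately show ?thesis
            by (metis image_eqI linear_span_image p_linear)
        qed
        fix \<phi> :: "'a \<Rightarrow> real"
        assume int: "\<And>x. x \<in> p ` K \<Longrightarrow> \<phi> x \<in> \<int>"
          and add: "\<And>x y. x \<in> p ` K \<Longrightarrow> y \<in> p ` K \<Longrightarrow> \<phi> (x - y) = \<phi> x - \<phi> y"
        \<comment> \<open>extend the functional to the whole lattice by zero on \<open>w\<close>; its representative lies in \<open>K\<close>\<close>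
        \<comment> \<open>because the extension vanishes on \<open>v\<close>\<close>
        define \<psi> where "\<psi> x = \<phi> (p (x - (v \<bullet> J x) *\<^sub>R w))" for x
        have "\<exists>u\<in>L. \<forall>x\<in>L. \<psi> x = u \<bullet> J x"
        proof (rule unimodular)
          show "\<psi> x \<in> \<int>" if "x \<in> L" for x
            using int K_proj[OF that] by (auto simp: \<psi>_def)
          show "\<psi> (x - y) = \<psi> x - \<psi> y" if "x \<in> L" "y \<in> L" for x y
          proof -
            have "(x - y) - (v \<bullet> J (x - y)) *\<^sub>R w = (x - (v \<bullet> J x) *\<^sub>R w) - (y - (v \<bullet> J y) *\<^sub>R w)"
              by (simp add: J_diff inner_diff_right algebra_simps)
            moreover have "\<phi> (p (x - (v \<bullet> J x) *\<^sub>R w) - p (y - (v \<bullet> J y) *\<^sub>R w)) = \<psi> x - \<psi> y"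
              unfolding \<psi>_def using K_proj that by (intro add imageI)
            ultimately show ?thesis by (metis \<psi>_def p_diff)
          qed
        qed
        then obtain u where u: "u \<in> L" "\<And>x. x \<in> L \<Longrightarrow> \<psi> x = u \<bullet> J x" by blast
        have "\<phi> 0 = 0"
          using add[of 0 0] K0 linear_0[OF p_linear] by (metis diff_self imageI)
        then have "u \<bullet> J v = 0"
          using u(2)[OF v(1)] by (simp add: \<psi>_def p_v)
        then have vu: "v \<bullet> J u = 0" using J_skew[of v u] by (simp add: inner_commute)
        then have "u \<in> K" using u by (simp add: K_def)
        moreover have "\<phi> (p x) = p u \<bullet> J (p x)" if "x \<in> K" for x
          using that u(2)[of x] vu by (simp add: K_def \<psi>_def p_omega)
        ultimately show "\<exists>u\<in>p ` K. \<forall>x\<in>p ` K. \<phi> x = u \<bullet> J x" by blast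
      qed
      ultimately obtain x where x: "x \<in> K" "p x \<noteq> 0" "p x \<bullet> p x \<le> 2 * 4 ^ dim (p ` K)"
        using less.hyps False by blast
      obtain m :: int where m: "(x - of_int m *\<^sub>R v) \<bullet> (x - of_int m *\<^sub>R v) \<le> p x \<bullet> p x + (v \<bullet> v) / 4"
        using round[of x] by auto
      have "p (x - of_int m *\<^sub>R v) \<noteq> 0"
        using x(2) by (simp add: p_diff linear_scale[OF p_linear] p_v)
      then have "x - of_int m *\<^sub>R v \<noteq> 0" using linear_0[OF p_linear] by metis
      moreover have "x - of_int m *\<^sub>R v \<in> L" using x v K_L L_diff L_int_scale by blast
      ultimately have "v \<bullet> v \<le> 2 * (p x \<bullet> p x + (v \<bullet> v) / 4)"
        using min m by fastforce
      then have "v \<bullet> v \<le> 2 * 4 ^ Suc (dim (p ` K))" using x(3) by simp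
      also have "\<dots> \<le> 2 * 4 ^ dim L"
        using \<open>dim (p ` K) < dim L\<close> by (intro mult_left_mono power_increasing) auto
      finally show ?thesis using v by blast
    qed
  qed
qed

section \<open>Boundedness of the minima on the Siegel half space\<close>

definition stack :: "real^'n \<Rightarrow> real^'m \<Rightarrow> real^('n + 'm)" where
  "stack a b = (\<chi> i. case i of Inl k \<Rightarrow> a $ k | Inr k \<Rightarrow> b $ k)"

lemma stack_nth [simp]: "stack a b $ Inl k = a $ k" "stack a b $ Inr l = b $ l"
  by (simp_all add: stack_def)

lemma stack_eq_iff [simp]: "stack a b = stack c d \<longleftrightarrow> a = c \<and> b = d"
  by (metis stack_nth vec_eq_iff)

lemma stack_surj: "\<exists>a b. v = stack a b"
  by (intro exI[of _ "\<chi> k. v $ Inl k"] exI[of _ "\<chi> k. v $ Inr k"])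
     (simp add: stack_def vec_eq_iff split: sum.split)

lemma stack_zero [simp]: "stack 0 0 = 0"
  by (simp add: stack_def vec_eq_iff split: sum.split)

lemma inner_stack [simp]: "stack a b \<bullet> stack c d = a \<bullet> c + b \<bullet> d"
  by (simp add: inner_vec_def UNIV_sum sum.Plus[unfolded Plus_def])

lemma block_mat_stack:
  "block_mat A B C D *v stack a b = stack (A *v a + B *v b) (C *v a + D *v b)"
  by (auto simp: vec_eq_iff block_mat_def stack_def matrix_vector_mult_def UNIV_sum
      sum.Plus[unfolded Plus_def] split: sum.split)

lemma siegel_mat_stack:
  "siegel_mat Z *v stack a b =
    stack (mat_sqrt (matrix_inv (mat_Im Z)) *v (a + mat_Re Z *v b)) (mat_sqrt (mat_Im Z) *v b)"
  by (simp add: siegel_mat_def matrix_vector_mul_assoc[symmetric] block_mat_stack)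

lemma additive_on_int_vecs:
  fixes f :: "real^'n \<Rightarrow> real"
  assumes diff: "\<And>x y. x \<in> int_vecs \<Longrightarrow> y \<in> int_vecs \<Longrightarrow> f (x - y) = f x - f y"
    and x: "x \<in> int_vecs"
  shows "f x = (\<chi> i. f (axis i 1)) \<bullet> x"
proof -
  have iv_diff: "a - b \<in> int_vecs" if "a \<in> int_vecs" "b \<in> int_vecs" for a b :: "real^'n"
    using that by (auto simp: int_vecs_def)
  have iv0: "0 \<in> (int_vecs :: (real^'n) set)" by (simp add: int_vecs_def)
  have f0: "f 0 = 0" using diff[OF iv0 iv0] by simp
  have minus: "f (- a) = - f a" if "a \<in> int_vecs" for a
    using diff[OF iv0 that] f0 by simp
  have uminus: "- a \<in> int_vecs" if "a \<in> int_vecs" for a :: "real^'n"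
    using that by (auto simp: int_vecs_def)
  have add: "f (a + b) = f a + f b" if "a \<in> int_vecs" "b \<in> int_vecs" for a b
    using diff[OF that(1) uminus[OF that(2)]] minus[OF that(2)] by simp
  have ax: "c *\<^sub>R axis i 1 \<in> (int_vecs :: (real^'n) set)" if "c \<in> \<int>" for c i
    using that by (auto simp: int_vecs_def axis_def)
  have nat: "f (real n *\<^sub>R axis i 1) = real n * f (axis i 1)" for n i
  proof (induction n)
    case (Suc n)
    have "f (axis i 1 + real n *\<^sub>R axis i 1) = f (axis i 1) + f (real n *\<^sub>R axis i 1)"
      using ax[of 1 i] ax[of "real n" i] by (intro add) auto
    then show ?case using Suc by (simp add: algebra_simps)
  qed (simp add: f0)
  have int: "f (c *\<^sub>R axis i 1) = c * f (axis i 1)" if c: "c \<in> \<int>" for c i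
  proof -
    obtain k :: int where k: "c = of_int k" using c by (auto elim: Ints_cases)
    show ?thesis
    proof (cases "k \<ge> 0")
      case True
      then show ?thesis using nat[of "nat k" i] k by simp
    next
      case False
      then show ?thesis using nat[of "nat (- k)" i] minus[OF ax[of "- c" i]] c k by simp
    qed
  qed
  have "(\<Sum>i\<in>S. x $ i *\<^sub>R axis i 1) \<in> int_vecs \<and>
      f (\<Sum>i\<in>S. x $ i *\<^sub>R axis i 1) = (\<Sum>i\<in>S. x $ i * f (axis i 1))" if "finite S" for S
    using that
  proof (induction S)
    case (insert i S)
    have xi: "x $ i \<in> \<int>" using x by (simp add: int_vecs_def)
    have "(x $ i) *\<^sub>R axis i 1 + (\<Sum>i\<in>S. x $ i *\<^sub>R axis i 1) \<in> int_vecs"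
      using ax[OF xi, of i] insert.IH by (auto simp: int_vecs_def)
    then show ?case
      using insert add[OF ax[OF xi, of i]] int[OF xi] by simp
  qed (simp add: iv0 f0)
  from this[OF finite] have "f (\<Sum>i\<in>UNIV. x $ i *\<^sub>R axis i 1) = (\<Sum>i\<in>UNIV. x $ i * f (axis i 1))"
    by blast
  moreover have "(\<Sum>i\<in>UNIV. x $ i *\<^sub>R axis i 1) = x"
    using basis_expansion[of x] by (simp add: scalar_mult_eq_scaleR)
  ultimately show ?thesis by (simp add: inner_vec_def mult.commute)
qed

text \<open>
  The standard complex structure; \<open>x \<bullet> rot y\<close> is the standard symplectic form on pairs.
\<close>

definition rot :: "real^('n::finite + 'n) \<Rightarrow> real^('n + 'n)" where
  "rot v = stack (\<chi> k. v $ Inr k) (- (\<chi> k. v $ Inl k))"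

lemma rot_stack [simp]: "rot (stack a b) = stack b (- a)"
  by (simp add: rot_def)

text \<open>
  The matrix preserves the form \<open>x \<bullet> rot y\<close>, since its two diagonal blocks are symmetric and inverse to
  each other and \<open>X\<close> is symmetric. So everything reduces to the integral vectors, where it is
  immediate.
\<close>

lemma siegel_symplectic_lattice:
  fixes Z :: "complex^'g^'g"
  assumes Z: "Z \<in> siegel_half_space"
  shows "symplectic_lattice rot ((*v) (siegel_mat Z) ` int_vecs)" (is "symplectic_lattice _ ?L")
    and "span ((*v) (siegel_mat Z) ` int_vecs) = UNIV"
proof -
  let ?M = "siegel_mat Z"
  define X s t where "X = mat_Re Z" and "s = mat_sqrt (matrix_inv (mat_Im Z))" and "t = mat_sqrt (mat_Im Z)"
  have X: "transpose X = X" and Y: "transpose (mat_Im Z) = mat_Im Z" "pos_def_mat (mat_Im Z)"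
    using Z by (auto simp: siegel_half_space_def X_def)
  have st: "s ** t = mat 1" "t ** s = mat 1" and s: "transpose s = s" and t: "transpose t = t"
    unfolding s_def t_def using mat_sqrt_matrix_inv[OF Y] mat_sqrt[OF Y] by auto
  have M: "?M *v stack a b = stack (s *v (a + X *v b)) (t *v b)" for a b
    by (simp add: siegel_mat_stack X_def s_def t_def)
  have rot_inner: "rot x \<bullet> rot y = x \<bullet> y" and rot_rot: "rot (rot x) = - x" for x y :: "real^('g+'g)"
  proof -
    obtain a b c d where xy: "x = stack a b" "y = stack c d" using stack_surj by metis
    show "rot x \<bullet> rot y = x \<bullet> y" by (simp add: xy)
    show "rot (rot x) = - x" by (simp add: xy) (simp add: vec_eq_iff stack_def split: sum.split)
  qed
  have rot_linear: "linear (rot :: real^('g+'g) \<Rightarrow> _)"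
    by (simp add: linear_iff rot_def stack_def vec_eq_iff split: sum.split)
  have rot_int: "rot x \<in> int_vecs" if "x \<in> int_vecs" for x :: "real^('g+'g)"
    using that by (auto simp: int_vecs_def rot_def stack_def split: sum.split)
  have symp: "(?M *v x) \<bullet> rot (?M *v y) = x \<bullet> rot y" for x y
  proof -
    obtain a b c d where xy: "x = stack a b" "y = stack c d" using stack_surj by metis
    have "(s *v p) \<bullet> (t *v q) = p \<bullet> q" "(t *v q) \<bullet> (s *v p) = q \<bullet> p" for p q
      by (metis matrix_vector_mul_assoc matrix_vector_mul_lid s st(1) symmetric_mat_inner)
         (metis matrix_vector_mul_assoc matrix_vector_mul_lid t st(2) symmetric_mat_inner)
    then show ?thesis
      using symmetric_mat_inner[OF X, of b d]
      by (simp add: xy M inner_add_left inner_add_right inner_diff_right)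
  qed
  have surj: "\<exists>x. ?M *v x = y" for y
  proof -
    obtain c d where y: "y = stack c d" using stack_surj by metis
    have "?M *v stack (t *v c - X *v (s *v d)) (s *v d) = y"
      by (simp add: M y matrix_vector_mul_assoc st)
    then show ?thesis ..
  qed
  have "Basis \<subseteq> (int_vecs :: (real^('g+'g)) set)"
    by (auto simp: int_vecs_def Basis_vec_def axis_def)
  then have "span (int_vecs :: (real^('g+'g)) set) = UNIV"
    by (metis span_Basis span_mono top.extremum_uniqueI)
  then have "span ?L = range ((*v) ?M)"
    by (simp add: linear_span_image matrix_vector_mul_linear)
  then show span: "span ?L = UNIV" using surj by (metis surjI surj_def)
  show "symplectic_lattice rot ?L"
  proof (rule symplectic_lattice.intro)
    show "linear (rot :: real^('g+'g) \<Rightarrow> _)" by (rule rot_linear)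
    show "rot (rot x) = - x" for x :: "real^('g+'g)" by (rule rot_rot)
    show "rot x \<bullet> rot y = x \<bullet> y" for x y :: "real^('g+'g)" by (rule rot_inner)
    have "0 \<in> (int_vecs :: (real^('g+'g)) set)" by (simp add: int_vecs_def)
    then show "0 \<in> ?L" by (metis image_eqI matrix_vector_mult_0_right)
    have diff: "x - y \<in> int_vecs" if "x \<in> int_vecs" "y \<in> int_vecs" for x y :: "real^('g+'g)"
      using that by (auto simp: int_vecs_def)
    show "x - y \<in> ?L" if "x \<in> ?L" "y \<in> ?L" for x y
      using that diff by (auto simp flip: matrix_vector_mult_diff_distrib)
    show "x \<bullet> rot y \<in> \<int>" if xy: "x \<in> ?L" "y \<in> ?L" for x y
    proof -
      obtain a b where "x = ?M *v a" "y = ?M *v b" and ab: "a \<in> int_vecs" "b \<in> int_vecs"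
        using xy by auto
      then have "x \<bullet> rot y = a \<bullet> rot b" by (simp add: symp)
      then have "x \<bullet> rot y = (\<Sum>i\<in>UNIV. a $ i * rot b $ i)" by (simp add: inner_vec_def)
      then show ?thesis
        using ab rot_int[OF ab(2)] by (auto simp: int_vecs_def intro!: Ints_sum Ints_mult)
    qed
    show "rot x \<in> span ?L" for x by (simp add: span)
    fix \<phi> :: "real^('g+'g) \<Rightarrow> real"
    assume int: "\<And>x. x \<in> ?L \<Longrightarrow> \<phi> x \<in> \<int>"
      and add: "\<And>x y. x \<in> ?L \<Longrightarrow> y \<in> ?L \<Longrightarrow> \<phi> (x - y) = \<phi> x - \<phi> y"
    define c where "c = (\<chi> i. \<phi> (?M *v axis i 1))"
    have c: "\<phi> (?M *v x) = c \<bullet> x" if "x \<in> int_vecs" for x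
      unfolding c_def using that
      by (intro additive_on_int_vecs) (simp_all add: matrix_vector_mult_diff_distrib add)
    have "c \<in> int_vecs"
      unfolding int_vecs_def c_def by (auto intro!: int) (auto simp: int_vecs_def axis_def)
    then have "?M *v rot c \<in> ?L" using rot_int by blast
    moreover have "\<phi> x = (?M *v rot c) \<bullet> rot x" if "x \<in> ?L" for x
      using that by (auto simp: c symp rot_inner)
    ultimately show "\<exists>u\<in>?L. \<forall>x\<in>?L. \<phi> x = u \<bullet> rot x" by blast
  qed
qed

lemma lattice_min_le:
  assumes "l \<in> int_vecs" "l \<noteq> 0"
  shows "lattice_min Z \<le> (norm (siegel_mat Z *v l))\<^sup>2"
  unfolding lattice_min_def using assms
  by (intro cINF_lower bdd_belowI2[of _ 0]) auto

lemma lattice_min_bounded: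
  fixes Z :: "complex^'g^'g"
  assumes Z: "Z \<in> siegel_half_space"
  shows "lattice_min Z \<le> 2 * 4 ^ DIM(real^('g + 'g))"
proof -
  let ?L = "(*v) (siegel_mat Z) ` int_vecs"
  have "?L \<noteq> {0}"
  proof
    assume "?L = {0}"
    with siegel_symplectic_lattice(2)[OF Z] have "(UNIV :: (real^('g+'g)) set) = {0}" by simp
    then have "DIM(real^('g+'g)) = 0" by (metis dim_UNIV dim_singleton)
    then show False by simp
  qed
  then obtain x where "x \<in> ?L" "x \<noteq> 0" "x \<bullet> x \<le> 2 * 4 ^ dim ?L"
    using symplectic_lattice_short_vector[OF siegel_symplectic_lattice(1)[OF Z]] by blast
  then obtain l where l: "l \<in> int_vecs" "siegel_mat Z *v l \<noteq> 0"
    "(norm (siegel_mat Z *v l))\<^sup>2 \<le> 2 * 4 ^ dim ?L"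
    by (auto simp: dot_square_norm)
  from l(2) have "l \<noteq> 0" by auto
  have "(2::real) * 4 ^ dim ?L \<le> 2 * 4 ^ DIM(real^('g + 'g))"
    by (intro mult_left_mono power_increasing dim_subset_UNIV) auto
  with lattice_min_le[OF l(1) \<open>l \<noteq> 0\<close>, of Z] l(3) show ?thesis by linarith
qed

section \<open>Counting integral points in balls\<close>

text \<open>
  The open unit cubes with lower corners at the points are disjoint, and they lie in a ball whose
  radius exceeds \<open>R\<close> by the diagonal of a cube.
\<close>

lemma card_int_vecs_in_ball_le:
  fixes F :: "(real^'n) set"
  assumes fin: "finite F" and int: "F \<subseteq> int_vecs" and R: "\<And>x. x \<in> F \<Longrightarrow> norm x < R" "R \<ge> 0"
  shows "real (card F) \<le> unit_ball_vol (CARD('n)) * (R + sqrt (CARD('n))) ^ CARD('n)"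
proof -
  define e :: "real^'n" where "e = (\<chi> i. 1)"
  have [simp]: "e $ i = 1" for i by (simp add: e_def)
  have cube: "measure lebesgue (box x (x + e)) = 1" for x
  proof -
    have "e \<bullet> b = 1" if "b \<in> Basis" for b
      using that by (auto simp: Basis_vec_def inner_axis)
    then show ?thesis
      by (simp add: measure_completion measure_lborel_box_eq inner_add_left)
  qed
  have ne: "norm e = sqrt (CARD('n))"
    by (simp add: norm_vec_def L2_set_def)
  have "real (card F) = (\<Sum>x\<in>F. measure lebesgue (box x (x + e)))"
    by (simp add: cube)
  also have "\<dots> = measure lebesgue (\<Union>x\<in>F. box x (x + e))"
  proof (rule measure_UNION'[symmetric])
    show "pairwise (\<lambda>x y. disjnt (box x (x + e)) (box y (y + e))) F"
    proof (rule pairwiseI, unfold disjnt_iff, intro allI notI, elim conjE)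
      fix x y z assume xy: "x \<in> F" "y \<in> F" "x \<noteq> y" and z: "z \<in> box x (x + e)" "z \<in> box y (y + e)"
      have "x $ i = y $ i" for i
      proof -
        obtain a b :: int where "x $ i = of_int a" "y $ i = of_int b"
          using xy int by (metis (no_types, lifting) Ints_cases int_vecs_def mem_Collect_eq subset_iff)
        moreover from z have "x $ i < z $ i \<and> z $ i < x $ i + 1" "y $ i < z $ i \<and> z $ i < y $ i + 1"
          by (simp_all add: mem_box_cart)
        ultimately have "a < b + 1" "b < a + 1" "x $ i = of_int a" "y $ i = of_int b" by linarith+
        then show ?thesis by simp
      qed
      with xy(3) show False by (simp add: vec_eq_iff)
    qed
  qed (use fin in auto)
  also have "\<dots> \<le> measure lebesgue (ball (0 :: real^'n) (R + norm e))"
  proof (rule measure_mono_fmeasurable)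
    show "(\<Union>x\<in>F. box x (x + e)) \<subseteq> ball 0 (R + norm e)"
    proof
      fix z assume "z \<in> (\<Union>x\<in>F. box x (x + e))"
      then obtain x where x: "x \<in> F" "z \<in> box x (x + e)" by blast
      have "norm (z - x) \<le> norm e"
      proof (rule norm_le_componentwise_cart)
        show "norm ((z - x) $ i) \<le> norm (e $ i)" for i
          using x(2)[unfolded mem_box_cart, rule_format, of i] by simp
      qed
      then show "z \<in> ball 0 (R + norm e)"
        using norm_triangle_ineq[of x "z - x"] R(1)[OF x(1)] by simp
    qed
  qed (use fin in \<open>auto intro!: sets.finite_UN\<close>)
  also have "\<dots> = unit_ball_vol (CARD('n)) * (R + sqrt (CARD('n))) ^ CARD('n)"
    using R(2) by (simp add: measure_completion content_ball ne)
  finally show ?thesis .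
qed

definition sq_norm :: "int^'g::finite \<Rightarrow> int" where
  "sq_norm v = (\<Sum>i\<in>UNIV. (v $ i)\<^sup>2)"

lemma sq_norm_uminus [simp]: "sq_norm (- v) = sq_norm v"
  by (simp add: sq_norm_def)

lemma sq_norm_ge: "(v $ i)\<^sup>2 \<le> sq_norm v"
  unfolding sq_norm_def by (rule member_le_sum) auto

lemma sq_norm_nonneg: "0 \<le> sq_norm v"
  unfolding sq_norm_def by (intro sum_nonneg) auto

definition real_vec :: "int^'n \<Rightarrow> real^'n" where
  "real_vec v = (\<chi> i. of_int (v $ i))"

lemma real_vec_eq_iff: "real_vec u = real_vec v \<longleftrightarrow> u = v"
  by (simp add: real_vec_def vec_eq_iff)

lemma inner_real_vec: "real_vec v \<bullet> real_vec v = of_int (sq_norm v)"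
  by (simp add: real_vec_def inner_vec_def sq_norm_def power2_eq_square)

lemma stack_int_vecsE:
  assumes "l \<in> int_vecs"
  obtains a b where "l = stack (real_vec a) (real_vec b)"
proof -
  have "\<exists>k::int. l $ i = of_int k" for i using assms by (auto simp: int_vecs_def elim: Ints_cases)
  then obtain f :: "_ \<Rightarrow> int" where f: "\<And>i. l $ i = of_int (f i)" by metis
  have "l = stack (real_vec (\<chi> i. f (Inl i))) (real_vec (\<chi> i. f (Inr i)))"
    by (simp add: vec_eq_iff stack_def real_vec_def f split: sum.split)
  then show thesis by (rule that)
qed

text \<open>
  The bound from the volume also holds for each finite subset, which yields finiteness.
\<close>

lemma finite_card_short_pairs:
  fixes P :: "((int^'g) \<times> (int^'g)) set"
  assumes short: "\<And>u x. (u, x) \<in> P \<Longrightarrow> of_int (sq_norm u + sq_norm x) < \<rho>" and \<rho>: "\<rho> \<ge> 0"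
    and lt: "unit_ball_vol (2 * CARD('g)) * (sqrt \<rho> + sqrt (2 * CARD('g))) ^ (2 * CARD('g)) < real m"
  shows "finite P \<and> card P < m"
proof -
  have card: "CARD('g + 'g) = 2 * CARD('g)" by simp
  have bound: "card G \<le> m - 1" if G: "G \<subseteq> P" "finite G" for G
  proof -
    define \<iota> where "\<iota> = (\<lambda>(u, x). stack (real_vec u) (real_vec x) :: real^('g + 'g))"
    have inj: "inj_on \<iota> G" by (auto simp: inj_on_def \<iota>_def real_vec_eq_iff)
    have "real (card (\<iota> ` G)) \<le> unit_ball_vol (CARD('g + 'g)) * (sqrt \<rho> + sqrt (CARD('g + 'g))) ^ CARD('g + 'g)"
    proof (rule card_int_vecs_in_ball_le)
      show "\<iota> ` G \<subseteq> int_vecs"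
        by (auto simp: \<iota>_def int_vecs_def stack_def real_vec_def split: sum.split)
      show "norm z < sqrt \<rho>" if z: "z \<in> \<iota> ` G" for z
      proof -
        obtain u x where "(u, x) \<in> P" "z = stack (real_vec u) (real_vec x)"
          using z G(1) by (auto simp: \<iota>_def)
        then have "z \<bullet> z < \<rho>" using short by (simp add: inner_real_vec)
        then show ?thesis by (simp add: norm_eq_sqrt_inner)
      qed
    qed (use G \<rho> in auto)
    then have "real (card G) < real m"
      using lt unfolding card card_image[OF inj] by simp
    then show ?thesis by simp
  qed
  then have "finite P \<and> card P \<le> m - 1" by (intro finite_if_finite_subsets_card_bdd) auto
  moreover have "m > 0"
  proof -
    have "0 \<le> unit_ball_vol (2 * CARD('g)) * (sqrt \<rho> + sqrt (2 * CARD('g))) ^ (2 * CARD('g))"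
      using \<rho> by (intro mult_nonneg_nonneg zero_le_power) auto
    with lt show ?thesis by linarith
  qed
  ultimately show ?thesis by linarith
qed

section \<open>Primes congruent to 3 modulo 4\<close>

text \<open>
  An odd number all of whose prime factors are congruent to 1 modulo 4 is itself congruent to 1
  modulo 4.
\<close>

lemma prime_factor_3_mod_4:
  fixes n :: nat
  assumes "n mod 4 = 3"
  shows "\<exists>p. prime p \<and> p dvd n \<and> p mod 4 = 3"
  using assms
proof (induction n rule: less_induct)
  case (less n)
  have "n \<noteq> 1" using less.prems by auto
  then obtain p where p: "prime p" "p dvd n" using prime_factor_nat by blast
  then obtain m where m: "n = p * m" by auto
  show ?case
  proof (cases "p mod 4 = 3")
    case False
    have "odd n" using less.prems by presburger
    then have "odd p" using m by simp
    then have p1: "p mod 4 = 1" using False by presburger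
    have "n mod 4 = (p mod 4) * m mod 4" unfolding m by (simp add: mod_mult_left_eq)
    then have m3: "m mod 4 = 3" using p1 less.prems by simp
    moreover have "m < n"
      using prime_gt_1_nat[OF p(1)] m m3 by (cases "m = 0") auto
    ultimately obtain q where "prime q" "q dvd m" "q mod 4 = 3" using less.IH by blast
    then show ?thesis using m by auto
  qed (use p in blast)
qed

lemma arbitrarily_large_prime_3_mod_4:
  obtains p :: nat where "prime p" "p > N" "p mod 4 = 3"
proof -
  obtain q :: nat where q: "fact N = Suc q" using fact_nonzero not0_implies_Suc by blast
  define m where "m = 4 * q + 3"
  have m: "4 * fact N = m + 1" by (simp add: m_def q)
  have "m mod 4 = 3" by (simp add: m_def)
  then obtain p where p: "prime p" "p dvd m" "p mod 4 = 3"
    using prime_factor_3_mod_4[of m] by blast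
  have "p > N"
  proof (rule ccontr)
    assume "\<not> p > N"
    then have "p dvd fact N" using prime_gt_0_nat[OF p(1)] by (intro dvd_fact) auto
    then have "p dvd m + 1" unfolding m[symmetric] by (rule dvd_mult)
    with p(2) have "p dvd 1" using dvd_add_right_iff by blast
    then show False using p(1) by simp
  qed
  with p that show thesis by blast
qed

lemma fermat_int:
  fixes a :: int
  assumes p: "prime (p::nat)" and a: "\<not> int p dvd a"
  shows "[a ^ (p - 1) = 1] (mod int p)"
proof -
  define b where "b = nat (a mod int p)"
  have p0: "int p > 0" using p prime_gt_0_nat by simp
  have b: "int b = a mod int p" using p0 by (simp add: b_def)
  have "\<not> p dvd b"
    using a b by (metis dvd_mod_iff dvd_refl int_dvd_int_iff)
  then have "[b ^ (p - 1) = 1] (mod p)" using p by (intro fermat_theorem)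
  then have "[int b ^ (p - 1) = 1] (mod int p)"
    by (metis cong_int_iff of_nat_1 of_nat_power)
  moreover have "[int b = a] (mod int p)" by (simp add: b cong_def)
  ultimately show ?thesis by (meson cong_pow cong_sym cong_trans)
qed

text \<open>
  Otherwise raising \<open>a\<^sup>2 \<equiv> - b\<^sup>2\<close> to the odd power \<open>(p - 1) / 2\<close> would give \<open>1 \<equiv> - 1\<close> by Fermat's
  theorem. In other words, \<open>\<int>[i] / p\<close> has no zero divisors.
\<close>

lemma prime_3_mod_4_dvd_sum_squares:
  fixes a b :: int
  assumes p: "prime (p::nat)" "p mod 4 = 3" and dvd: "int p dvd a * a + b * b"
  shows "int p dvd a"
proof (rule ccontr)
  assume a: "\<not> int p dvd a"
  have pr: "prime (int p)" using p(1) by simp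
  have b: "\<not> int p dvd b"
  proof
    assume "int p dvd b"
    then have "int p dvd a * a" using dvd by (metis dvd_add_left_iff dvd_mult)
    then show False using a pr by (simp add: prime_dvd_mult_iff)
  qed
  define h where "h = (p - 1) div 2"
  have h: "p - 1 = 2 * h" and "odd h" using p(2) unfolding h_def by presburger+
  have "[a * a = - (b * b)] (mod int p)" using dvd by (simp add: cong_iff_dvd_diff)
  then have "[(a * a) ^ h = (- (b * b)) ^ h] (mod int p)" by (rule cong_pow)
  then have "[a ^ (p - 1) = - (b ^ (p - 1))] (mod int p)"
    unfolding h power_mult power2_eq_square using \<open>odd h\<close> by simp
  moreover have "[- (b ^ (p - 1)) = - 1] (mod int p)"
    using fermat_int[OF p(1) b] by (simp add: cong_minus_minus_iff)
  ultimately have "[1 = - 1] (mod int p)"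
    using fermat_int[OF p(1) a] by (meson cong_sym cong_trans)
  then have "int p dvd 2" by (simp add: cong_iff_dvd_diff)
  then have "p \<le> 2" using zdvd_imp_le by fastforce
  then show False using p(2) prime_gt_1_nat[OF p(1)] by auto
qed

section \<open>Averaging over symmetric matrices that anticommute with i\<close>

lemma card_vec_range:
  "card {v :: int^'g. \<forall>i. v $ i \<in> {0..<int p}} = p ^ CARD('g)"
  "finite {v :: int^'g. \<forall>i. v $ i \<in> {0..<int p}}"
proof -
  have "bij_betw vec_nth {v :: int^'g. \<forall>i. v $ i \<in> {0..<int p}} (PiE UNIV (\<lambda>_. {0..<int p}))"
    by (rule bij_betwI[where g = vec_lambda]) auto
  moreover have "card (PiE (UNIV :: 'g set) (\<lambda>_. {0..<int p})) = p ^ CARD('g)"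
    by (simp add: card_PiE)
  moreover have "finite (PiE (UNIV :: 'g set) (\<lambda>_. {0..<int p}))"
    by (intro finite_PiE) auto
  ultimately show "card {v :: int^'g. \<forall>i. v $ i \<in> {0..<int p}} = p ^ CARD('g)"
    "finite {v :: int^'g. \<forall>i. v $ i \<in> {0..<int p}}"
    by (auto dest: bij_betw_same_card bij_betw_finite)
qed

definition solves :: "nat \<Rightarrow> int^'g::finite^'g \<Rightarrow> int^'g \<Rightarrow> int^'g \<Rightarrow> bool" where
  "solves p T u x \<longleftrightarrow> (\<forall>i. [(T *v x) $ i = u $ i] (mod int p))"

definition reduce :: "nat \<Rightarrow> int^'g::finite^'g \<Rightarrow> int^'g^'g" where
  "reduce p T = (\<chi> i k. T $ i $ k mod int p)"

lemma solves_reduce: "solves p (reduce p T) u x \<longleftrightarrow> solves p T u x"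
proof -
  have "[(reduce p T *v x) $ i = (T *v x) $ i] (mod int p)" for i
    unfolding matrix_vector_mult_def reduce_def
    by (simp, intro cong_sum cong_mult) (simp_all add: cong_def)
  then show ?thesis unfolding solves_def by (meson cong_sym cong_trans)
qed

lemma solves_add: "solves p S u x \<Longrightarrow> solves p T v x \<Longrightarrow> solves p (S + T) (u + v) x"
  by (simp add: solves_def matrix_vector_mult_add_rdistrib cong_add)

text \<open>
  An identification of the integral vectors with vectors of Gaussian integers that leaves the index
  type as it is. The involution \<open>\<sigma>\<close> exchanges the real and the imaginary part of a complex coordinate;
  the sign \<open>s\<close> is \<open>- 1\<close> on real and \<open>1\<close> on imaginary parts, so that \<open>mul_i\<close> below is
  multiplication by \<open>i\<close>.
\<close>

locale gaussian_coordinates =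
  fixes \<sigma> :: "'g::finite \<Rightarrow> 'g" and s :: "'g \<Rightarrow> int"
  assumes \<sigma>_\<sigma> [simp]: "\<sigma> (\<sigma> i) = i" and s_\<sigma> [simp]: "s (\<sigma> i) = - s i" and s_s [simp]: "s i * s i = 1"
begin

lemma s_s_mult [simp]: "s i * (s i * x) = x"
  by (simp add: mult.assoc[symmetric])

definition mul_i :: "int^'g \<Rightarrow> int^'g" where
  "mul_i v = (\<chi> i. s i * v $ \<sigma> i)"

lemma mul_i_mul_i [simp]: "mul_i (mul_i v) = - v"
  by (simp add: mul_i_def vec_eq_iff)

lemma mul_i_uminus [simp]: "mul_i (- v) = - mul_i v"
  by (simp add: mul_i_def vec_eq_iff)

lemma mul_i_eq_0_iff [simp]: "mul_i v = 0 \<longleftrightarrow> v = 0"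
proof
  assume "mul_i v = 0"
  then have "mul_i (mul_i v) = mul_i 0" by simp
  then show "v = 0" by (simp add: mul_i_def[of 0] flip: zero_vec_def)
qed (simp add: mul_i_def vec_eq_iff)

lemma sum_\<sigma>: "(\<Sum>i\<in>UNIV. f (\<sigma> i)) = (\<Sum>i\<in>UNIV. f i)"
  by (rule sum.reindex_bij_witness[of _ \<sigma> \<sigma>]) auto

lemma \<sigma>_neq: "\<sigma> i \<noteq> i"
  using s_\<sigma>[of i] s_s[of i] by (metis add.inverse_inverse equation_minus_iff mult_zero_left neg_equal_zero zero_neq_one)

lemma sum_squares_mul_i: "(\<Sum>i\<in>UNIV. (mul_i v $ i)\<^sup>2) = (\<Sum>i\<in>UNIV. (v $ i)\<^sup>2)"
  using sum_\<sigma>[of "\<lambda>i. (v $ i)\<^sup>2"] by (simp add: mul_i_def power2_eq_square mult.assoc mult.left_commute)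

text \<open>
  The second condition says, entry by entry, that \<open>T\<close> anticommutes with
  \<open>mul_i\<close> modulo \<open>p\<close>. Symmetry is required exactly and not only modulo \<open>p\<close>, because \<open>T / p\<close> has to be
  the real part of a point of the Siegel space.
\<close>

definition gaussian_symmetric :: "nat \<Rightarrow> int^'g^'g \<Rightarrow> bool" where
  "gaussian_symmetric p T \<longleftrightarrow> (\<forall>i k. T $ i $ k = T $ k $ i) \<and>
    (\<forall>i k. int p dvd T $ \<sigma> i $ \<sigma> k + s i * s k * T $ i $ k)"

definition gaussian_family :: "nat \<Rightarrow> (int^'g^'g) set" where
  "gaussian_family p = {T. gaussian_symmetric p T \<and> (\<forall>i k. T $ i $ k \<in> {0..<int p})}"

lemma gaussian_symmetric_add:
  assumes "gaussian_symmetric p S" "gaussian_symmetric p T"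
  shows "gaussian_symmetric p (S + T)"
proof -
  have "int p dvd (S + T) $ \<sigma> i $ \<sigma> k + s i * s k * (S + T) $ i $ k" for i k
    using dvd_add[of "int p" "S $ \<sigma> i $ \<sigma> k + s i * s k * S $ i $ k" "T $ \<sigma> i $ \<sigma> k + s i * s k * T $ i $ k"] assms
    by (simp add: gaussian_symmetric_def algebra_simps)
  then show ?thesis using assms by (simp add: gaussian_symmetric_def)
qed

lemma reduce_in_gaussian_family:
  assumes "gaussian_symmetric p T" "p > 0"
  shows "reduce p T \<in> gaussian_family p"
proof -
  have "int p dvd T $ \<sigma> i $ \<sigma> k mod int p + s i * s k * (T $ i $ k mod int p)" for i k
  proof -
    have "int p dvd T $ \<sigma> i $ \<sigma> k + s i * s k * T $ i $ k"
      using assms by (simp add: gaussian_symmetric_def)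
    then show ?thesis
      by (simp add: dvd_eq_mod_eq_0 mod_add_left_eq) (metis mod_add_right_eq mod_mult_right_eq)
  qed
  then show ?thesis
    using assms by (auto simp: gaussian_family_def gaussian_symmetric_def reduce_def)
qed

lemma finite_gaussian_family: "finite (gaussian_family p)"
proof -
  have "finite {T :: int^'g^'g. \<forall>i. T $ i \<in> {v. \<forall>k. v $ k \<in> {0..<int p}}}"
  proof -
    have "vec_lambda ` (PiE UNIV (\<lambda>_::'g. {v :: int^'g. \<forall>k. v $ k \<in> {0..<int p}}))
        \<supseteq> {T :: int^'g^'g. \<forall>i. T $ i \<in> {v. \<forall>k. v $ k \<in> {0..<int p}}}"
    proof
      fix T assume "T \<in> {T :: int^'g^'g. \<forall>i. T $ i \<in> {v. \<forall>k. v $ k \<in> {0..<int p}}}"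
      then show "T \<in> vec_lambda ` (PiE UNIV (\<lambda>_::'g. {v :: int^'g. \<forall>k. v $ k \<in> {0..<int p}}))"
        by (intro image_eqI[of _ _ "vec_nth T"]) auto
    qed
    moreover have "finite (PiE UNIV (\<lambda>_::'g. {v :: int^'g. \<forall>k. v $ k \<in> {0..<int p}}))"
      using card_vec_range(2) by (intro finite_PiE) auto
    ultimately show ?thesis by (meson finite_imageI finite_subset)
  qed
  then show ?thesis by (rule rev_finite_subset) (auto simp: gaussian_family_def)
qed

text \<open>
  Over the field \<open>\<int>[i] / p\<close>, with a functional \<open>b\<close> satisfying \<open>b x = 1\<close>, the symmetric matrix
  \<open>S = u b\<^sup>t + b u\<^sup>t - (u\<^sup>t x) b b\<^sup>t\<close> satisfies \<open>S x = u\<close>. The matrix \<open>T\<close> below is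
  such a matrix, composed with complex conjugation, in real coordinates. Here \<open>b\<close> is supported on one
  complex coordinate at which \<open>x\<close> does not vanish, and there it is the inverse of that coordinate
  up to conjugation.
\<close>

lemma gaussian_symmetric_solution:
  fixes x u :: "int^'g"
  assumes p: "prime p" "p mod 4 = 3" and k: "\<not> int p dvd x $ k"
  shows "\<exists>T. gaussian_symmetric p T \<and> solves p T u x"
proof -
  define N where "N = x $ k * x $ k + x $ \<sigma> k * x $ \<sigma> k"
  have "\<not> int p dvd N"
    using prime_3_mod_4_dvd_sum_squares[OF p, of "x $ k" "x $ \<sigma> k"] k unfolding N_def by blast
  then have "coprime N (int p)"
    using prime_imp_coprime[of "int p" N] p(1) by (simp add: coprime_commute)
  then obtain c where c: "[N * c = 1] (mod int p)" using cong_solve_coprime_int by blast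
  define b :: "int^'g" where "b = (\<chi> i. if i = k \<or> i = \<sigma> k then c * x $ i else 0)"
  define d where "d = mul_i b"
  define w where "w = mul_i u"
  have two: "(\<Sum>i\<in>UNIV. f i) = f k + f (\<sigma> k)" if "\<And>i. i \<noteq> k \<Longrightarrow> i \<noteq> \<sigma> k \<Longrightarrow> f i = 0" for f :: "'g \<Rightarrow> int"
  proof -
    have "(\<Sum>i\<in>UNIV. f i) = (\<Sum>i\<in>{k, \<sigma> k}. f i)"
      using that by (intro sum.mono_neutral_right) auto
    then show ?thesis using \<sigma>_neq[of k] by simp
  qed
  have bx: "(\<Sum>i\<in>UNIV. b $ i * x $ i) = N * c"
    by (subst two) (auto simp: b_def N_def algebra_simps)
  have \<sigma>_eq: "\<sigma> i = k \<longleftrightarrow> i = \<sigma> k" for i by (metis \<sigma>_\<sigma>)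
  have dx: "(\<Sum>i\<in>UNIV. d $ i * x $ i) = 0"
  proof (subst two)
    show "d $ i * x $ i = 0" if "i \<noteq> k" "i \<noteq> \<sigma> k" for i
      using that \<sigma>_eq[of i] \<sigma>_eq[of "\<sigma> i"] by (simp add: d_def mul_i_def b_def)
  qed (simp add: d_def mul_i_def b_def)
  define A where "A = (\<Sum>i\<in>UNIV. u $ i * x $ i)"
  define B where "B = (\<Sum>i\<in>UNIV. w $ i * x $ i)"
  define T :: "int^'g^'g" where "T = (\<chi> i l. u $ i * b $ l + b $ i * u $ l - w $ i * d $ l - d $ i * w $ l
      - A * (b $ i * b $ l - d $ i * d $ l) + B * (b $ i * d $ l + d $ i * b $ l))"
  have rot: "u $ \<sigma> i = s i * w $ i" "w $ \<sigma> i = - s i * u $ i"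
    "b $ \<sigma> i = s i * d $ i" "d $ \<sigma> i = - s i * b $ i" for i
    by (simp_all add: mul_i_def w_def d_def)
  have "T $ \<sigma> i $ \<sigma> l + s i * s l * T $ i $ l = 0" for i l
    by (simp add: T_def rot) (simp add: algebra_simps)
  moreover have "T $ i $ l = T $ l $ i" for i l
    by (simp add: T_def algebra_simps)
  ultimately have "gaussian_symmetric p T" by (simp add: gaussian_symmetric_def)
  moreover have "solves p T u x"
    unfolding solves_def
  proof
    fix i
    have "(T *v x) $ i = (\<Sum>l\<in>UNIV. u $ i * (b $ l * x $ l) + b $ i * (u $ l * x $ l) - w $ i * (d $ l * x $ l)
       - d $ i * (w $ l * x $ l) - A * (b $ i * (b $ l * x $ l)) + A * (d $ i * (d $ l * x $ l))
       + B * (b $ i * (d $ l * x $ l)) + B * (d $ i * (b $ l * x $ l)))"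
      by (simp add: matrix_vector_mult_def T_def algebra_simps)
    also have "\<dots> = u $ i * (N * c) + b $ i * A - d $ i * B - A * (b $ i * (N * c)) + B * (d $ i * (N * c))"
      by (simp only: sum.distrib sum_subtractf sum_distrib_left[symmetric] bx dx A_def[symmetric] B_def[symmetric])
    finally have eq: "(T *v x) $ i = u $ i * (N * c) + b $ i * A - d $ i * B - A * (b $ i * (N * c)) + B * (d $ i * (N * c))" .
    \<comment> \<open>exact up to the defect \<open>N c - 1\<close> of the modular inverse\<close>
    have "(T *v x) $ i - u $ i = (N * c - 1) * (u $ i - b $ i * A + B * d $ i)"
      unfolding eq by (simp add: algebra_simps)
    moreover have "int p dvd N * c - 1" using c by (simp add: cong_iff_dvd_diff)
    ultimately show "[(T *v x) $ i = u $ i] (mod int p)"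
      by (simp add: cong_iff_dvd_diff)
  qed
  ultimately show ?thesis by blast
qed

text \<open>
  Choose for each residue vector \<open>v\<close> a member \<open>M v\<close> with \<open>M v x \<equiv> v\<close>. The sums \<open>T + M v\<close>, with \<open>T\<close> a
  solution for \<open>u\<close>, are pairwise incongruent: the value \<open>u + v\<close> at \<open>x\<close> determines \<open>v\<close>, and then the sum
  determines \<open>T\<close>.
\<close>

lemma card_solutions_le:
  fixes x u :: "int^'g"
  assumes p: "prime p" "p mod 4 = 3" and k: "\<not> int p dvd x $ k"
  shows "card {T \<in> gaussian_family p. solves p T u x} * p ^ CARD('g) \<le> card (gaussian_family p)"
proof -
  have p0: "p > 0" using p(1) prime_gt_0_nat by blast
  define V where "V = {v :: int^'g. \<forall>i. v $ i \<in> {0..<int p}}"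
  define F where "F = {T \<in> gaussian_family p. solves p T u x}"
  obtain M where M: "\<And>v. gaussian_symmetric p (M v)" "\<And>v. solves p (M v) v x"
    using gaussian_symmetric_solution[OF p k] by metis
  define h where "h = (\<lambda>(T, v). reduce p (T + M v))"
  have "inj_on h (F \<times> V)"
  proof (rule inj_onI, clarify)
    fix T v T' v' assume T: "T \<in> F" "T' \<in> F" and v: "v \<in> V" "v' \<in> V" and eq: "h (T, v) = h (T', v')"
    have "solves p (h (T, v)) (u + v) x" "solves p (h (T', v')) (u + v') x"
      using T M by (auto simp: h_def solves_reduce F_def intro: solves_add)
    then have "[u $ i + v $ i = u $ i + v' $ i] (mod int p)" for i
      unfolding eq solves_def by (metis cong_sym cong_trans vector_add_component)
    then have "[v $ i = v' $ i] (mod int p)" for i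
      by (simp add: cong_add_lcancel)
    then have vv: "v = v'"
      using v by (auto simp: V_def vec_eq_iff cong_def)
    have "[T $ i $ k + M v $ i $ k = T' $ i $ k + M v $ i $ k] (mod int p)" for i k
      using arg_cong[OF eq, of "\<lambda>X. X $ i $ k"] by (simp add: h_def reduce_def vv cong_def)
    then have "[T $ i $ k = T' $ i $ k] (mod int p)" for i k
      by (simp add: cong_add_rcancel)
    then have "T = T'"
      using T by (auto simp: F_def gaussian_family_def vec_eq_iff cong_def)
    with vv show "T = T' \<and> v = v'" by simp
  qed
  moreover have "h ` (F \<times> V) \<subseteq> gaussian_family p"
    using M(1) p0 by (auto simp: h_def F_def gaussian_family_def[of p] intro!: reduce_in_gaussian_family[unfolded gaussian_family_def, simplified] gaussian_symmetric_add)
  ultimately have "card (F \<times> V) \<le> card (gaussian_family p)"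
    using finite_gaussian_family by (metis card_inj_on_le)
  then show ?thesis
    unfolding card_cartesian_product F_def V_def card_vec_range(1) .
qed

lemma sq_norm_mul_i [simp]: "sq_norm (mul_i v) = sq_norm v"
  by (simp add: sq_norm_def sum_squares_mul_i)

text \<open>
  The lattice of \<open>T\<close> is invariant because \<open>T\<close> anticommutes with \<open>mul_i\<close>; this is the source of
  the factor 4.
\<close>

lemma solves_mul_i:
  assumes T: "gaussian_symmetric p T" and ux: "solves p T u x"
  shows "solves p T (mul_i u) (- mul_i x)"
  unfolding solves_def
proof
  fix i
  have "int p dvd s l * T $ i $ \<sigma> l - s i * T $ \<sigma> i $ l" for l
  proof -
    have "int p dvd T $ \<sigma> (\<sigma> i) $ \<sigma> l + s (\<sigma> i) * s l * T $ \<sigma> i $ l"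
      using T unfolding gaussian_symmetric_def by blast
    then have "int p dvd s l * (T $ i $ \<sigma> l - s i * s l * T $ \<sigma> i $ l)" by simp
    then show ?thesis by (simp add: right_diff_distrib mult.left_commute[of "s l" "s i"] mult.assoc)
  qed
  then have "[s l * T $ i $ \<sigma> l = s i * T $ \<sigma> i $ l] (mod int p)" for l
    by (simp add: cong_iff_dvd_diff)
  then have "[(\<Sum>l\<in>UNIV. (s l * T $ i $ \<sigma> l) * x $ l) = (\<Sum>l\<in>UNIV. (s i * T $ \<sigma> i $ l) * x $ l)] (mod int p)"
    by (intro cong_sum cong_scalar_right)
  moreover have "(\<Sum>l\<in>UNIV. (s l * T $ i $ \<sigma> l) * x $ l) = (T *v (- mul_i x)) $ i"
    using sum_\<sigma>[of "\<lambda>l. T $ i $ l * (- mul_i x) $ l"]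
    by (simp add: matrix_vector_mult_def mul_i_def mult.commute mult.left_commute)
  moreover have "(\<Sum>l\<in>UNIV. (s i * T $ \<sigma> i $ l) * x $ l) = s i * (T *v x) $ \<sigma> i"
    by (simp add: matrix_vector_mult_def sum_distrib_left mult.assoc)
  moreover have "[s i * (T *v x) $ \<sigma> i = s i * u $ \<sigma> i] (mod int p)"
    using ux unfolding solves_def by (intro cong_mult cong_refl) simp
  ultimately show "[(T *v (- mul_i x)) $ i = mul_i u $ i] (mod int p)"
    by (simp add: mul_i_def) (meson cong_trans)
qed

lemma vec_int_eq_uminus: "(v :: int^'g) = - v \<longleftrightarrow> v = 0"
  by (auto simp: vec_eq_iff)

lemma card_orbit:
  assumes "(u, x) \<noteq> (0, 0)"
  shows "card {(u, x), (mul_i u, - mul_i x), (- u, - x), (- mul_i u, mul_i x)} = 4"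
proof -
  have 1: "v \<noteq> mul_i v" "v \<noteq> - mul_i v" if "v \<noteq> 0" for v
  proof -
    have "v = - v" if "v = mul_i v" using mul_i_mul_i[of v] that by metis
    moreover have "v = - v" if "v = - mul_i v"
      using mul_i_mul_i[of v] that by (metis minus_equation_iff mul_i_uminus)
    ultimately show "v \<noteq> mul_i v" "v \<noteq> - mul_i v" using that vec_int_eq_uminus by blast+
  qed
  have 2: "v \<noteq> - v" if "v \<noteq> 0" for v :: "int^'g" using that vec_int_eq_uminus by blast
  have 3: "mul_i v \<noteq> - v" "mul_i v \<noteq> - mul_i v" "- v \<noteq> - mul_i v" "- v \<noteq> mul_i v" "- mul_i v \<noteq> mul_i v" if "v \<noteq> 0" for v
    using 1[OF that] 2[of "mul_i v"] that by (auto simp: minus_equation_iff[of v] equation_minus_iff[of _ v])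
  have orbit_distinct: "distinct [v, mul_i v, - v, - mul_i v]" if "v \<noteq> 0" for v
    using 1[OF that] 2[OF that] 3[OF that] unfolding distinct.simps list.set
    by (metis empty_iff insert_iff)
  have "distinct [(u, x), (mul_i u, - mul_i x), (- u, - x), (- mul_i u, mul_i x)]"
  proof (cases "u = 0")
    case False
    from orbit_distinct[OF this] show ?thesis
      unfolding distinct.simps list.set by (metis empty_iff insert_iff prod.inject)
  next
    case True
    then have "x \<noteq> 0" using assms by simp
    from orbit_distinct[OF this] show ?thesis
      unfolding distinct.simps list.set by (metis empty_iff insert_iff prod.inject)
  qed
  from distinct_card[OF this] show ?thesis by simp
qed

text \<open>
  Double counting of the pairs of a matrix and a short vector of its lattice. If every lattice had a
  short vector, each would have four, so the family would contribute at least four times its size;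
  but each short vector contributes at most the fraction \<open>p\<^sup>-\<^sup>g\<close> of the size. A pair with
  \<open>x \<equiv> 0\<close> contributes nothing: then \<open>u \<equiv> 0\<close> too, and the pair has squared norm at least \<open>p\<^sup>2\<close>.
\<close>

lemma exists_without_short_solution:
  fixes P :: "((int^'g) \<times> (int^'g)) set"
  assumes p: "prime p" "p mod 4 = 3" and \<rho>: "\<rho> \<le> (real p)\<^sup>2"
    and P: "P = {(u, x). (u, x) \<noteq> (0, 0) \<and> of_int (sq_norm u + sq_norm x) < \<rho>}"
    and fin: "finite P" and card: "card P < 4 * p ^ CARD('g)"
  shows "\<exists>T\<in>gaussian_family p. \<forall>u x. solves p T u x \<longrightarrow> (u, x) \<noteq> (0, 0) \<longrightarrow> \<rho> \<le> of_int (sq_norm u + sq_norm x)"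
proof (rule ccontr)
  assume contra: "\<not> ?thesis"
  define S where "S T = {z \<in> P. solves p T (fst z) (snd z)}" for T
  have finS: "finite (S T)" for T using fin by (simp add: S_def)
  have "4 \<le> card (S T)" if T: "T \<in> gaussian_family p" for T
  proof -
    obtain u x where ux: "solves p T u x" "(u, x) \<noteq> (0, 0)" "of_int (sq_norm u + sq_norm x) < \<rho>"
      using contra T by (meson not_le)
    have g: "gaussian_symmetric p T" using T by (simp add: gaussian_family_def)
    have s1: "solves p T (mul_i u) (- mul_i x)" using solves_mul_i[OF g ux(1)] .
    have s2: "solves p T (- u) (- x)" using solves_mul_i[OF g s1] by simp
    have s3: "solves p T (- mul_i u) (mul_i x)" using solves_mul_i[OF g s2] by simp
    have "{(u, x), (mul_i u, - mul_i x), (- u, - x), (- mul_i u, mul_i x)} \<subseteq> S T"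
      using ux s1 s2 s3 by (auto simp: S_def P)
    from card_mono[OF finS this] card_orbit[OF ux(2)] show ?thesis by simp
  qed
  then have "(\<Sum>T\<in>gaussian_family p. 4) \<le> (\<Sum>T\<in>gaussian_family p. card (S T))" by (rule sum_mono)
  also have "\<dots> = (\<Sum>z\<in>P. card {T \<in> gaussian_family p. solves p T (fst z) (snd z)})"
    unfolding S_def card_eq_sum sum.inter_filter[OF fin] sum.inter_filter[OF finite_gaussian_family]
    by (rule sum.swap)
  finally have le: "4 * card (gaussian_family p) \<le> (\<Sum>z\<in>P. card {T \<in> gaussian_family p. solves p T (fst z) (snd z)})"
    by simp
  have "card {T \<in> gaussian_family p. solves p T (fst z) (snd z)} * p ^ CARD('g) \<le> card (gaussian_family p)" if z: "z \<in> P" for z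
  proof -
    obtain u x where ux: "z = (u, x)" by force
    show ?thesis
    proof (cases "\<exists>k. \<not> int p dvd x $ k")
      case True
      then show ?thesis using card_solutions_le[OF p] by (auto simp: ux)
    next
      case False
      have "\<not> solves p T u x" for T
      proof
        assume "solves p T u x"
        then have "int p dvd u $ i" for i
        proof -
          have "int p dvd (T *v x) $ i"
            unfolding matrix_vector_mult_def using False by (auto intro!: dvd_sum)
          moreover have "[(T *v x) $ i = u $ i] (mod int p)"
            using \<open>solves p T u x\<close> by (simp add: solves_def)
          ultimately show ?thesis by (simp add: cong_dvd_iff)
        qed
        with False have dvd: "int p dvd u $ i" "int p dvd x $ i" for i by auto
        have big: "(int p)\<^sup>2 \<le> sq_norm v" if v: "\<And>i. int p dvd v $ i" "v \<noteq> 0" for v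
        proof -
          obtain i where "v $ i \<noteq> 0" using v(2) by (auto simp: vec_eq_iff)
          then have "int p \<le> \<bar>v $ i\<bar>" using dvd_imp_le_int[of "v $ i" "int p"] v(1)[of i] by simp
          then have "(int p)\<^sup>2 \<le> \<bar>v $ i\<bar>\<^sup>2" by (intro power_mono) auto
          then show ?thesis using sq_norm_ge[of v i] by simp
        qed
        have "(int p)\<^sup>2 \<le> sq_norm u + sq_norm x"
          using z big[of u] big[of x] dvd sq_norm_nonneg[of u] sq_norm_nonneg[of x]
          by (cases "u = 0") (auto simp: ux P)
        then have "(real p)\<^sup>2 \<le> of_int (sq_norm u + sq_norm x)"
          by (metis of_int_le_iff of_int_of_nat_eq of_int_power)
        then show False using z \<rho> by (simp add: ux P)
      qed
      then show ?thesis by (simp add: ux)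
    qed
  qed
  then have "(\<Sum>z\<in>P. card {T \<in> gaussian_family p. solves p T (fst z) (snd z)} * p ^ CARD('g)) \<le> (\<Sum>z\<in>P. card (gaussian_family p))"
    by (rule sum_mono)
  then have "(\<Sum>z\<in>P. card {T \<in> gaussian_family p. solves p T (fst z) (snd z)}) * p ^ CARD('g) \<le> card P * card (gaussian_family p)"
    by (simp add: sum_distrib_right)
  then have "4 * card (gaussian_family p) * p ^ CARD('g) \<le> card P * card (gaussian_family p)"
    using le by (meson mult_le_mono1 order_trans)
  moreover have "card (gaussian_family p) > 0"
  proof -
    have "0 \<in> gaussian_family p" using prime_gt_0_nat[OF p(1)] by (simp add: gaussian_family_def gaussian_symmetric_def)
    then show ?thesis using finite_gaussian_family card_gt_0_iff by blast
  qed
  ultimately have "4 * p ^ CARD('g) \<le> card P" by (simp add: mult.commute mult.left_commute)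
  with card show False by simp
qed

end

text \<open>
  Number the indices from zero and pair each even number with its successor.
\<close>

lemma gaussian_coordinates_exist:
  assumes "even CARD('g::finite)"
  obtains \<sigma> :: "'g::finite \<Rightarrow> 'g" and s where "gaussian_coordinates \<sigma> s"
proof -
  obtain f :: "'g \<Rightarrow> nat" where f: "bij_betw f UNIV {0..<CARD('g)}"
    using ex_bij_betw_finite_nat[of "UNIV :: 'g set"] by auto
  define h where "h = inv_into UNIV f"
  have inj: "inj f" and ran: "range f = {0..<CARD('g)}" using f by (auto simp: bij_betw_def)
  have hf: "h (f i) = i" for i using inj by (simp add: h_def)
  have fh: "f (h m) = m" if "m < CARD('g)" for m
    using that ran by (auto simp: h_def f_inv_into_f)
  define t where "t m = (if even m then m + 1 else m - 1)" for m :: nat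
  have t: "t (t m) = m" "even (t m) \<longleftrightarrow> odd m" "m < CARD('g) \<Longrightarrow> t m < CARD('g)" for m
    using assms by (auto simp: t_def elim!: evenE oddE)
  have "f i < CARD('g)" for i using ran by (metis atLeastLessThan_iff rangeI)
  then have ft: "f (h (t (f i))) = t (f i)" for i by (simp add: fh t)
  define \<sigma> where "\<sigma> i = h (t (f i))" for i
  define s :: "'g \<Rightarrow> int" where "s i = (if even (f i) then 1 else - 1)" for i
  have "gaussian_coordinates \<sigma> s"
    by unfold_locales (auto simp: \<sigma>_def s_def ft t hf)
  then show thesis by (rule that)
qed

section \<open>The lattices of the family and the lower bound\<close>

text \<open>
  After division by \<open>p\<^sup>g\<close> the left-hand side tends to the volume \<open>(\<pi> r)\<^sup>g / g!\<close> of a ball of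
  radius \<open>\<surd>r\<close> in dimension \<open>2 g\<close>.
\<close>

lemma short_vector_volume_eventually_small:
  fixes r :: real
  assumes r: "r \<ge> 0" and lt: "(pi * r) ^ g < 4 * fact g"
  shows "\<exists>N. \<forall>p\<ge>N. p > 0 \<longrightarrow>
    unit_ball_vol (2 * g) * (sqrt (r * real p) + sqrt (2 * g)) ^ (2 * g) < real (4 * p ^ g)"
proof -
  let ?V = "unit_ball_vol (real (2 * g))"
  have "(\<lambda>p::nat. ?V * (sqrt r + sqrt (2 * real g / real p)) ^ (2 * g)) \<longlonglongrightarrow> ?V * (sqrt r + sqrt 0) ^ (2 * g)"
    by (intro tendsto_intros lim_const_over_n)
  moreover have "?V * (sqrt r + sqrt 0) ^ (2 * g) = (pi * r) ^ g / fact g"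
    unfolding unit_ball_vol_even using r by (simp add: power_mult power_mult_distrib)
  moreover have "(pi * r) ^ g / fact g < 4" using lt by (simp add: divide_less_eq)
  ultimately have "\<forall>\<^sub>F p in sequentially. ?V * (sqrt r + sqrt (2 * real g / real p)) ^ (2 * g) < 4"
    by (intro order_tendstoD(2)) auto
  then obtain N where N: "\<And>p. p \<ge> N \<Longrightarrow> ?V * (sqrt r + sqrt (2 * real g / real p)) ^ (2 * g) < 4"
    by (auto simp: eventually_sequentially)
  have "?V * (sqrt (r * real p) + sqrt (2 * g)) ^ (2 * g) < real (4 * p ^ g)" if p: "p \<ge> N" "p > 0" for p
  proof -
    have "sqrt (r * real p) + sqrt (2 * g) = sqrt (real p) * (sqrt r + sqrt (2 * real g / real p))"
      using p(2) by (simp add: real_sqrt_mult real_sqrt_divide field_simps)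
    then have "?V * (sqrt (r * real p) + sqrt (2 * g)) ^ (2 * g)
        = real p ^ g * (?V * (sqrt r + sqrt (2 * real g / real p)) ^ (2 * g))"
      by (simp add: power_mult_distrib power_mult)
    also have "\<dots> < real p ^ g * 4"
      using N[OF p(1)] p(2) by (intro mult_strict_left_mono) auto
    finally show ?thesis by (simp add: mult.commute)
  qed
  then show ?thesis by blast
qed

lemma mat_scalar_mult_vec: "(mat c :: real^'n^'n) *v v = c *\<^sub>R v"
  by (simp add: vec_eq_iff matrix_vector_mult_def mat_def if_distrib [where f = "\<lambda>x. x * _"] cong: if_cong)

lemma mat_scalar_mult_mat: "(mat c :: real^'n^'n) ** mat d = mat (c * d)"
proof -
  have "(*v) ((mat c :: real^'n^'n) ** mat d) = (*v) (mat (c * d))"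
    by (simp add: fun_eq_iff matrix_vector_mul_assoc[symmetric] mat_scalar_mult_vec)
  then show ?thesis by (metis matrix_of_matrix_vector_mul)
qed

lemma pos_def_mat_scalar: "c > 0 \<Longrightarrow> pos_def_mat (mat c)"
  by (simp add: pos_def_mat_def mat_scalar_mult_vec)

lemma mat_sqrt_scalar:
  assumes "c > 0"
  shows "mat_sqrt (mat c) = mat (sqrt c)"
  using assms by (intro mat_sqrt_eqI) (simp_all add: pos_def_mat_scalar mat_scalar_mult_mat transpose_mat)

text \<open>
  At these points the square roots in \<open>siegel_mat\<close> are scalar, so the lattice is a rescaled
  sublattice of the integral vectors.
\<close>

definition congruence_point :: "nat \<Rightarrow> int^'g^'g \<Rightarrow> complex^'g^'g" where
  "congruence_point p T = (\<chi> i k. Complex (of_int (T $ i $ k) / real p) (if i = k then 1 / real p else 0))"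

lemma mat_Im_congruence_point: "mat_Im (congruence_point p T) = mat (1 / real p)"
  by (simp add: mat_Im_def congruence_point_def mat_def vec_eq_iff)

lemma congruence_point_in_siegel_half_space:
  assumes "p > 0" "transpose T = T"
  shows "congruence_point p T \<in> siegel_half_space"
proof -
  have "T $ i $ k = T $ k $ i" for i k
    using assms(2) by (metis transpose_def vec_lambda_beta)
  then have "transpose (mat_Re (congruence_point p T)) = mat_Re (congruence_point p T)"
    by (simp add: mat_Re_def congruence_point_def transpose_def vec_eq_iff)
  then show ?thesis
    using assms(1) by (simp add: siegel_half_space_def mat_Im_congruence_point pos_def_mat_scalar transpose_mat)
qed

lemma norm_siegel_mat_congruence_point:
  fixes T :: "int^'g^'g"
  assumes p: "p > 0"
  shows "(norm (siegel_mat (congruence_point p T) *v stack (real_vec a) (real_vec b)))\<^sup>2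
    = of_int (sq_norm (int p *s a + T *v b) + sq_norm b) / real p"
proof -
  have inv: "matrix_inv (mat (1 / real p) :: real^'g^'g) = mat (real p)"
    using p by (intro matrix_inv_eqI) (simp add: mat_scalar_mult_mat)
  have "real_vec (int p *s a + T *v b) $ i = real p * (real_vec a + mat_Re (congruence_point p T) *v real_vec b) $ i" for i
    using p by (simp add: real_vec_def mat_Re_def congruence_point_def matrix_vector_mult_def sum_distrib_left
        distrib_left)
  then have u: "real_vec (int p *s a + T *v b) = real p *\<^sub>R (real_vec a + mat_Re (congruence_point p T) *v real_vec b)"
    by (simp add: vec_eq_iff)
  define w where "w = real_vec a + mat_Re (congruence_point p T) *v real_vec b"
  have "(norm (siegel_mat (congruence_point p T) *v stack (real_vec a) (real_vec b)))\<^sup>2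
      = real p * (w \<bullet> w) + (real_vec b \<bullet> real_vec b) / real p"
    using p by (simp add: siegel_mat_stack mat_Im_congruence_point inv mat_sqrt_scalar mat_scalar_mult_vec
        w_def[symmetric] power2_norm_eq_inner real_sqrt_divide) 
  also have "real p * (w \<bullet> w) = of_int (sq_norm (int p *s a + T *v b)) / real p"
    using p by (simp add: inner_real_vec[symmetric] u w_def[symmetric])
  finally show ?thesis by (simp add: inner_real_vec add_divide_distrib)
qed

text \<open>
  A lattice vector with coordinates \<open>(a, b)\<close> is the pair \<open>(p a + T b, b)\<close>, scaled by \<open>p\<^sup>-\<^sup>1\<^sup>/\<^sup>2\<close>.
\<close>

lemma lattice_min_congruence_point_ge:
  fixes T :: "int^'g^'g"
  assumes p: "p > 0"
    and long: "\<And>u x. solves p T u x \<Longrightarrow> (u, x) \<noteq> (0, 0) \<Longrightarrow> r * real p \<le> of_int (sq_norm u + sq_norm x)"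
  shows "r \<le> lattice_min (congruence_point p T)"
  unfolding lattice_min_def
proof (rule cINF_greatest)
  have "axis i 1 \<in> (int_vecs :: (real^('g+'g)) set) - {0}" for i
    by (auto simp: int_vecs_def axis_def vec_eq_iff)
  then show "int_vecs - {0 :: real^('g+'g)} \<noteq> {}" by blast
  fix l :: "real^('g+'g)" assume l: "l \<in> int_vecs - {0}"
  then obtain a b where ab: "l = stack (real_vec a) (real_vec b)" using stack_int_vecsE by blast
  let ?u = "int p *s a + T *v b"
  have "solves p T ?u b" by (simp add: solves_def cong_iff_dvd_diff)
  moreover have "(?u, b) \<noteq> (0, 0)"
  proof
    assume "(?u, b) = (0, 0)"
    then have "b = 0" "int p *s a = 0" by auto
    then have "a = 0" using p by (simp add: vec_eq_iff)
    with \<open>b = 0\<close> have "l = 0" by (simp add: ab real_vec_def zero_vec_def[symmetric])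
    with l show False by simp
  qed
  ultimately have "r * real p \<le> of_int (sq_norm ?u + sq_norm b)" by (rule long)
  then show "r \<le> (norm (siegel_mat (congruence_point p T) *v l))\<^sup>2"
    unfolding ab norm_siegel_mat_congruence_point[OF p] using p by (simp add: le_divide_eq)
qed

lemma exists_large_lattice_min:
  fixes r :: real
  assumes even: "even CARD('g)" and r: "r \<ge> 0" and lt: "(pi * r) ^ CARD('g::finite) < 4 * fact CARD('g)"
  shows "\<exists>Z\<in>(siegel_half_space :: (complex^'g^'g) set). r \<le> lattice_min Z"
proof -
  obtain \<sigma> :: "'g \<Rightarrow> 'g" and s where "gaussian_coordinates \<sigma> s"
    using gaussian_coordinates_exist[OF even] .
  then interpret gaussian_coordinates \<sigma> s .
  obtain N where N: "\<And>p. p \<ge> N \<Longrightarrow> p > 0 \<Longrightarrow> unit_ball_vol (2 * CARD('g)) *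
      (sqrt (r * real p) + sqrt (2 * CARD('g))) ^ (2 * CARD('g)) < real (4 * p ^ CARD('g))"
    using short_vector_volume_eventually_small[OF r lt] by blast
  obtain p where p: "prime p" "p mod 4 = 3" and large: "p > max N (nat \<lceil>r\<rceil>)"
    using arbitrarily_large_prime_3_mod_4 by metis
  have p0: "p > 0" using large by simp
  have "r \<le> real p" using large by linarith
  then have rp: "r * real p \<le> (real p)\<^sup>2" by (simp add: power2_eq_square mult_right_mono)
  define P :: "((int^'g) \<times> (int^'g)) set"
    where "P = {(u, x). (u, x) \<noteq> (0, 0) \<and> of_int (sq_norm u + sq_norm x) < r * real p}"
  have "finite P \<and> card P < 4 * p ^ CARD('g)"
    using N[of p] large p0 r by (intro finite_card_short_pairs[of P "r * real p"]) (auto simp: P_def)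
  then obtain T where T: "T \<in> gaussian_family p"
    "\<And>u x. solves p T u x \<Longrightarrow> (u, x) \<noteq> (0, 0) \<Longrightarrow> r * real p \<le> of_int (sq_norm u + sq_norm x)"
    using exists_without_short_solution[OF p rp P_def] by metis
  have "transpose T = T"
    using T(1) by (simp add: gaussian_family_def gaussian_symmetric_def transpose_def vec_eq_iff)
  then have "congruence_point p T \<in> siegel_half_space"
    using p0 by (intro congruence_point_in_siegel_half_space)
  moreover have "r \<le> lattice_min (congruence_point p T)"
    using T(2) by (rule lattice_min_congruence_point_ge[OF p0])
  ultimately show ?thesis by blast
qed

theorem theorem1p1:
  fixes n g :: nat
  assumes "n \<ge> 1" and "g = 2 * n" and "CARD('g::finite) = g"
  shows "1 / pi * root g (4 * fact g) \<le> symplectic_hermite TYPE('g)"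
proof (rule dense_le_bounded)
  have g: "g > 0" using assms by simp
  then show "0 < 1 / pi * root g (4 * fact g)" by simp
  fix r assume r: "0 < r" "r < 1 / pi * root g (4 * fact g)"
  then have "pi * r < root g (4 * fact g)" by (simp add: field_simps)
  then have "(pi * r) ^ g < root g (4 * fact g) ^ g"
    using r(1) g by (intro power_strict_mono) auto
  also have "\<dots> = 4 * fact g" using g by (intro real_root_pow_pos2) auto
  finally have "(pi * r) ^ CARD('g) < 4 * fact CARD('g)" by (simp add: assms(3))
  then obtain Z where Z: "Z \<in> (siegel_half_space :: (complex^'g^'g) set)" "r \<le> lattice_min Z"
    using exists_large_lattice_min[where 'g = 'g and r = r] r(1) assms by auto
  have "bdd_above (lattice_min ` (siegel_half_space :: (complex^'g^'g) set))"
    using lattice_min_bounded by (intro bdd_aboveI2)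
  then have "lattice_min Z \<le> symplectic_hermite TYPE('g)"
    unfolding symplectic_hermite_def using Z(1) by (intro cSUP_upper)
  with Z(2) show "r \<le> symplectic_hermite TYPE('g)" by simp
qed

end
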